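(* Let $\Sigma=\{0,1,2,3\}$. There are exactly $2^{27}$ unitrades in $\Sigma^3$; they fall into exactly $2528$ equivalence classes, and exactly $312$ of these equivalence classes have representatives that are equivalent to their complements in $\Sigma^3$.
   Context: Let $\Sigma=\{0,1,2,3\}$. A line in $\Sigma^n$ is a set of $4$ words that agree in all coordinates but one. A set $S\subseteq\Sigma^n$ is a unitrade if every line contains an even number of elements of $S$. An isotopy is an $n$-tuple $\bar\theta=(\theta_1,\dots,\theta_n)$ of permutations of $\Sigma$, acting by $\bar\theta S=\{(\theta_1x_1,\dots,\theta_nx_n):x\in S\}$. Two sets $S_1,S_2\subseteq\Sigma^n$ are equivalent if $\sigma\bar\theta S_1=S_2$ for some isotopy $\bar\theta$ and some permutation $\sigma$ of the $n$ coordinates. *)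

theory Defs
  imports "HOL-Combinatorics.Permutations" "HOL-Library.FuncSet"
begin

definition Sigma4 :: "nat set" where
  "Sigma4 = {0, 1, 2, 3}"

text \<open>A word over the alphabet is an extensional function on the coordinate set \<open>{1..n}\<close>.\<close>

definition words :: "nat \<Rightarrow> (nat \<Rightarrow> nat) set" where
  "words n = {1..n} \<rightarrow>\<^sub>E Sigma4"

definition is_line :: "nat \<Rightarrow> (nat \<Rightarrow> nat) set \<Rightarrow> bool" where
  "is_line n L \<longleftrightarrow> L \<subseteq> words n \<and> card L = 4 \<and>
     (\<exists>i\<in>{1..n}. \<forall>x\<in>L. \<forall>y\<in>L. \<forall>j\<in>{1..n} - {i}. x j = y j)"

definition unitrades :: "nat \<Rightarrow> (nat \<Rightarrow> nat) set set" where
  "unitrades n = {S. S \<subseteq> words n \<and> (\<forall>L. is_line n L \<longrightarrow> even (card (L \<inter> S)))}"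

definition is_isotopy :: "nat \<Rightarrow> (nat \<Rightarrow> nat \<Rightarrow> nat) \<Rightarrow> bool" where
  "is_isotopy n \<theta> \<longleftrightarrow> (\<forall>i\<in>{1..n}. \<theta> i permutes Sigma4)"

definition isotopy_image ::
    "nat \<Rightarrow> (nat \<Rightarrow> nat \<Rightarrow> nat) \<Rightarrow> (nat \<Rightarrow> nat) set \<Rightarrow> (nat \<Rightarrow> nat) set" where
  "isotopy_image n \<theta> S = (\<lambda>x. \<lambda>i\<in>{1..n}. \<theta> i (x i)) ` S"

text \<open>Position \<open>i\<close> of the new word holds the old entry at \<open>\<sigma> i\<close>. The opposite convention
  (with the inverse of \<open>\<sigma>\<close>) gives the same notion of equivalence.\<close>

definition coord_perm_image ::
    "nat \<Rightarrow> (nat \<Rightarrow> nat) \<Rightarrow> (nat \<Rightarrow> nat) set \<Rightarrow> (nat \<Rightarrow> nat) set" where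
  "coord_perm_image n \<sigma> S = (\<lambda>x. \<lambda>i\<in>{1..n}. x (\<sigma> i)) ` S"

definition equivalent :: "nat \<Rightarrow> (nat \<Rightarrow> nat) set \<Rightarrow> (nat \<Rightarrow> nat) set \<Rightarrow> bool" where
  "equivalent n S1 S2 \<longleftrightarrow>
     (\<exists>\<theta> \<sigma>. is_isotopy n \<theta> \<and> \<sigma> permutes {1..n} \<and>
        coord_perm_image n \<sigma> (isotopy_image n \<theta> S1) = S2)"

definition unitrade_equiv :: "nat \<Rightarrow> ((nat \<Rightarrow> nat) set \<times> (nat \<Rightarrow> nat) set) set" where
  "unitrade_equiv n =
     {(S1, S2). S1 \<in> unitrades n \<and> S2 \<in> unitrades n \<and> equivalent n S1 S2}"

end

theory Submission
  imports Defs
begin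

text \<open>
  Write \<open>c\<close> for the identity or for complementation of unitrades. It commutes with the group \<open>G\<close> of
  order \<open>24\<^sup>3 \<cdot> 6\<close> generated by isotopies and coordinate permutations, and the double count behind the
  Cauchy--Frobenius lemma shows that the number of equivalence classes stable under \<open>c\<close> is the average
  over \<open>g \<in> G\<close> of the number of unitrades \<open>S\<close> with \<open>g S = c S\<close>.

  A unitrade in \<open>\<Sigma>\<^sup>3\<close> is an arbitrary function \<open>{0,1,2}\<^sup>3 \<rightarrow> GF(2)\<close>, extended to the letter 3 so that all
  line sums vanish. Hence there are \<open>2\<^sup>2\<^sup>7\<close> of them, and \<open>g S = c S\<close> is an affine system in 27 unknowns.
  Up to conjugacy \<open>g\<close> is one of \<open>5\<^sup>3\<close> isotopies, of \<open>5\<^sup>2\<close> elements inducing a transposition of the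
  coordinates, or of 5 elements inducing a 3-cycle; Gaussian elimination solves these 155 systems.
\<close>

subsection \<open>Counting orbits\<close>

text \<open>Left multiplication by \<open>h\<close> maps the first set injectively into the second,
  and left multiplication by \<open>h'\<close> maps the second injectively into the first.\<close>

lemma fiber_card_eq:
  fixes act :: "'g \<Rightarrow> 'x \<Rightarrow> 'x"
  assumes fin: "finite G"
    and closed: "\<And>h g. h \<in> G \<Longrightarrow> g \<in> G \<Longrightarrow> mul h g \<in> G"
    and inj: "\<And>h. h \<in> G \<Longrightarrow> inj_on (mul h) G"
    and act_mul: "\<And>h g. h \<in> G \<Longrightarrow> g \<in> G \<Longrightarrow> act (mul h g) x = act h (act g x)"
    and h: "h \<in> G" "act h y = z" and h': "h' \<in> G" "act h' z = y"
  shows "card {g \<in> G. act g x = y} = card {g \<in> G. act g x = z}"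
proof (rule antisym)
  show "card {g \<in> G. act g x = y} \<le> card {g \<in> G. act g x = z}"
    by (rule card_inj_on_le[of "mul h"])
      (use fin closed act_mul h in \<open>auto intro: inj_on_subset[OF inj]\<close>)
  show "card {g \<in> G. act g x = z} \<le> card {g \<in> G. act g x = y}"
    by (rule card_inj_on_le[of "mul h'"])
      (use fin closed act_mul h' in \<open>auto intro: inj_on_subset[OF inj]\<close>)
qed

text \<open>For \<open>c\<close> the identity this is the Cauchy--Frobenius lemma.\<close>

lemma twisted_orbit_count:
  fixes act :: "'g \<Rightarrow> 'x \<Rightarrow> 'x" and c :: "'x \<Rightarrow> 'x"
  assumes fin: "finite G" "finite X"
    and closed: "\<And>h g. h \<in> G \<Longrightarrow> g \<in> G \<Longrightarrow> mul h g \<in> G"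
    and inj: "\<And>h. h \<in> G \<Longrightarrow> inj_on (mul h) G"
    and act_closed: "\<And>g x. g \<in> G \<Longrightarrow> x \<in> X \<Longrightarrow> act g x \<in> X"
    and act_mul: "\<And>h g x. h \<in> G \<Longrightarrow> g \<in> G \<Longrightarrow> x \<in> X \<Longrightarrow> act (mul h g) x = act h (act g x)"
    and R: "R = {(x, y). x \<in> X \<and> y \<in> X \<and> (\<exists>g\<in>G. act g x = y)}" "equiv X R"
    and c_closed: "\<And>x. x \<in> X \<Longrightarrow> c x \<in> X"
    and c_act: "\<And>g x. g \<in> G \<Longrightarrow> x \<in> X \<Longrightarrow> c (act g x) = act g (c x)"
  shows "(\<Sum>g\<in>G. card {x \<in> X. act g x = c x}) = card G * card {C \<in> X // R. \<exists>x\<in>C. (x, c x) \<in> R}"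
proof -
  define k where "k x y = card {g \<in> G. act g x = y}" for x y
  have sym: "(y, x) \<in> R" if "(x, y) \<in> R" for x y
    using R(2) that by (meson equivE symE)
  have trans: "(x, z) \<in> R" if "(x, y) \<in> R" "(y, z) \<in> R" for x y z
    using R(2) that by (meson equivE transE)
  have k_eq: "k x y = k x z" if x: "x \<in> X" and yz: "(y, z) \<in> R" for x y z
  proof -
    obtain h h' where "h \<in> G" "act h y = z" "h' \<in> G" "act h' z = y"
      using yz sym[OF yz] R(1) by auto
    then show ?thesis
      unfolding k_def using fiber_card_eq[of G mul act x h y z h'] fin closed inj act_mul x
      by blast
  qed
  \<comment> \<open>Since \<open>k x y\<close> counts the elements carrying \<open>x\<close> to
    \<open>y\<close>, the double count splits into these class sums: a class contributes
    \<open>card G\<close> if \<open>c\<close> maps it into itself and nothing otherwise.\<close>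
  have sum_class: "(\<Sum>x\<in>C. k x (c x)) = (if \<exists>x\<in>C. (x, c x) \<in> R then card G else 0)"
    if C: "C \<in> X // R" for C
  proof (cases "\<exists>x\<in>C. (x, c x) \<in> R")
    case False
    have CX: "C \<subseteq> X"
      using C R(2) by (meson in_quotient_imp_subset)
    have "k x (c x) = 0" if "x \<in> C" for x
    proof -
      have "x \<in> X" "(x, c x) \<notin> R"
        using that CX False by auto
      then have "{g \<in> G. act g x = c x} = {}"
        using R(1) c_closed by auto
      then show ?thesis
        unfolding k_def by (metis card.empty)
    qed
    then show ?thesis
      using False by simp
  next
    case True
    then obtain x0 where x0: "x0 \<in> C" "(x0, c x0) \<in> R"
      by blast
    have CX: "C \<subseteq> X"
      using C R(2) by (meson in_quotient_imp_subset)
    have related: "(x, y) \<in> R" if "x \<in> C" "y \<in> C" for x y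
      using C R(2) that by (meson in_quotient_imp_in_rel insert_subset subset_empty empty_subsetI)
    \<comment> \<open>One stable member suffices: \<open>c\<close> commutes with the action, so if
      \<open>x\<close> lies in the orbit of \<open>x0\<close>, then \<open>c x\<close> lies in the
      orbit of \<open>c x0\<close>.\<close>
    have stable: "(x, c x) \<in> R" if x: "x \<in> C" for x
    proof -
      obtain g where g: "g \<in> G" "act g x0 = x"
        using related[OF x0(1) x] R(1) by auto
      have "x0 \<in> X" "x \<in> X"
        using x0(1) x CX by auto
      then have "(c x0, c x) \<in> R"
        using g c_act[of g x0] R(1) c_closed[of x0] c_closed[of x] by auto
      then show ?thesis
        using related[OF x x0(1)] x0(2) trans by blast
    qed
    have finC: "finite C"
      using CX fin(2) finite_subset by blast
    \<comment> \<open>Orbit-stabilizer: the sets of elements carrying \<open>x\<close> to the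
      various \<open>y\<close> in \<open>C\<close> partition \<open>G\<close>, and by
      \<open>k_eq\<close> all of them have size \<open>k x x\<close>.\<close>
    have size: "card C * k x x = card G" if x: "x \<in> C" for x
    proof -
      have "G = (\<Union>y\<in>C. {g \<in> G. act g x = y})"
      proof -
        have "act g x \<in> C" if "g \<in> G" for g
        proof -
          have "(x, act g x) \<in> R"
            using that x CX act_closed R(1) by auto
          then show ?thesis
            using C R(2) x by (meson in_quotient_imp_closed)
        qed
        then show ?thesis by auto
      qed
      then have "card G = card (\<Union>y\<in>C. {g \<in> G. act g x = y})"
        by simp
      also have "\<dots> = (\<Sum>y\<in>C. k x y)"
        unfolding k_def by (rule card_UN_disjoint) (use fin finC in auto)
      also have "\<dots> = (\<Sum>y\<in>C. k x x)"
        by (rule sum.cong) (use k_eq related x CX in blast)+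
      finally show ?thesis
        by simp
    qed
    have "k x (c x) = card G div card C" if x: "x \<in> C" for x
    proof -
      have "k x (c x) = k x x"
        using k_eq[of x x "c x"] stable[OF x] x CX by auto
      moreover have "card C > 0"
        using x finC card_gt_0_iff by blast
      ultimately show ?thesis
        using size[OF x] by (metis nonzero_mult_div_cancel_left less_irrefl)
    qed
    \<comment> \<open>Divisibility makes the truncating \<open>div\<close> exact, so the
      \<open>card C\<close> equal terms add up to \<open>card G\<close>.\<close>
    moreover have "card C dvd card G"
      using size[OF x0(1)] by (metis dvd_triv_left)
    ultimately show ?thesis
      using True by simp
  qed
  have "(\<Sum>g\<in>G. card {x \<in> X. act g x = c x}) = (\<Sum>g\<in>G. \<Sum>x\<in>X. if act g x = c x then 1 else 0)"
    using fin by (simp add: sum.inter_filter[symmetric])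
  also have "\<dots> = (\<Sum>x\<in>X. \<Sum>g\<in>G. if act g x = c x then 1 else 0)"
    by (rule sum.swap)
  also have "\<dots> = (\<Sum>x\<in>X. k x (c x))"
    unfolding k_def using fin by (simp add: sum.inter_filter[symmetric])
  also have "\<dots> = (\<Sum>x\<in>\<Union>(X // R). k x (c x))"
    using R(2) by (simp add: Union_quotient)
  also have "\<dots> = (\<Sum>C\<in>X // R. \<Sum>x\<in>C. k x (c x))"
  proof (subst sum.Union_disjoint)
    show "\<forall>A\<in>X // R. finite A"
      using fin(2) in_quotient_imp_subset[OF R(2)] finite_subset by blast
    show "\<forall>A\<in>X // R. \<forall>B\<in>X // R. A \<noteq> B \<longrightarrow> A \<inter> B = {}"
      using quotient_disj[OF R(2)] by blast
  qed simp
  also have "\<dots> = (\<Sum>C\<in>X // R. if \<exists>x\<in>C. (x, c x) \<in> R then card G else 0)"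
    by (rule sum.cong) (use sum_class in auto)
  also have "\<dots> = card G * card {C \<in> X // R. \<exists>x\<in>C. (x, c x) \<in> R}"
    using fin(2) R(2) by (simp add: sum.inter_filter[symmetric] finite_quotient equiv_type)
  finally show ?thesis .
qed

subsection \<open>The group action on unitrades\<close>

lemma finite_words: "finite (words n)"
  unfolding words_def Sigma4_def by (intro finite_PiE) auto

lemma word_update: "w \<in> words n \<Longrightarrow> i \<in> {1..n} \<Longrightarrow> a \<in> Sigma4 \<Longrightarrow> w(i := a) \<in> words n"
  unfolding words_def by (auto simp: PiE_iff extensional_def)

lemma inj_word_update: "inj_on (\<lambda>a. w(i := a)) A"
  by (rule inj_onI) (metis fun_upd_same)

text \<open>Four distinct words that agree off coordinate \<open>i\<close> have different letters at
  \<open>i\<close>, so they exhaust the alphabet there. Lines thus become pairs of a base word and a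
  direction, and parity can be counted on letters.\<close>

lemma is_line_iff:
  "is_line n L \<longleftrightarrow> (\<exists>w\<in>words n. \<exists>i\<in>{1..n}. L = (\<lambda>a. w(i := a)) ` Sigma4)"
proof
  assume L: "is_line n L"
  then obtain i where i: "i \<in> {1..n}" "\<And>x y j. x \<in> L \<Longrightarrow> y \<in> L \<Longrightarrow> j \<in> {1..n} - {i} \<Longrightarrow> x j = y j"
    unfolding is_line_def by blast
  have LW: "L \<subseteq> words n" and card: "card L = 4"
    using L unfolding is_line_def by auto
  then obtain w where w: "w \<in> L"
    by fastforce
  have "x \<in> (\<lambda>a. w(i := a)) ` Sigma4" if x: "x \<in> L" for x
  proof -
    have "x \<in> words n" "w \<in> words n"
      using x w LW by auto
    then have "x j = (w(i := x i)) j" for j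
      using i(2)[OF x w, of j] unfolding words_def
      by (cases "j \<in> {1..n}") (auto simp: PiE_iff extensional_def)
    then have "x = w(i := x i)"
      by blast
    moreover have "x i \<in> Sigma4"
      using \<open>x \<in> words n\<close> i(1) unfolding words_def by auto
    ultimately show ?thesis
      by blast
  qed
  then have "L \<subseteq> (\<lambda>a. w(i := a)) ` Sigma4"
    by blast
  moreover have "card ((\<lambda>a. w(i := a)) ` Sigma4) = 4"
    by (subst card_image[OF inj_word_update]) (simp add: Sigma4_def)
  ultimately have "L = (\<lambda>a. w(i := a)) ` Sigma4"
    using card by (intro card_subset_eq) (auto simp: Sigma4_def)
  then show "\<exists>w\<in>words n. \<exists>i\<in>{1..n}. L = (\<lambda>a. w(i := a)) ` Sigma4"
    using w LW i(1) by blast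
next
  assume "\<exists>w\<in>words n. \<exists>i\<in>{1..n}. L = (\<lambda>a. w(i := a)) ` Sigma4"
  then obtain w i where w: "w \<in> words n" "i \<in> {1..n}" and L: "L = (\<lambda>a. w(i := a)) ` Sigma4"
    by blast
  have "card L = 4"
    unfolding L by (subst card_image[OF inj_word_update]) (simp add: Sigma4_def)
  moreover have "L \<subseteq> words n"
    unfolding L using w word_update by blast
  moreover have "\<forall>x\<in>L. \<forall>y\<in>L. \<forall>j\<in>{1..n} - {i}. x j = y j"
    unfolding L by auto
  ultimately show "is_line n L"
    unfolding is_line_def using w(2) by blast
qed

lemma unitrades_iff:
  "S \<in> unitrades n \<longleftrightarrow> S \<subseteq> words n \<and>
     (\<forall>w\<in>words n. \<forall>i\<in>{1..n}. even (card {a \<in> Sigma4. w(i := a) \<in> S}))"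
proof -
  have "card ((\<lambda>a. w(i := a)) ` Sigma4 \<inter> S) = card {a \<in> Sigma4. w(i := a) \<in> S}" for w i
  proof -
    have "(\<lambda>a. w(i := a)) ` Sigma4 \<inter> S = (\<lambda>a. w(i := a)) ` {a \<in> Sigma4. w(i := a) \<in> S}"
      by auto
    then show ?thesis
      by (simp add: card_image[OF inj_word_update])
  qed
  moreover have "(\<forall>L. is_line n L \<longrightarrow> even (card (L \<inter> S))) \<longleftrightarrow>
      (\<forall>w\<in>words n. \<forall>i\<in>{1..n}. even (card ((\<lambda>a. w(i := a)) ` Sigma4 \<inter> S)))"
    unfolding is_line_iff by blast
  ultimately show ?thesis
    unfolding unitrades_def by simp
qed

lemma unitrades_subset: "S \<in> unitrades n \<Longrightarrow> S \<subseteq> words n"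
  by (simp add: unitrades_def)

lemma finite_unitrades: "finite (unitrades n)"
  by (rule finite_subset[of _ "Pow (words n)"]) (auto simp: unitrades_def finite_words)

text \<open>A line has four words, so passing to the complement replaces a count \<open>m\<close> by
  \<open>4 - m\<close>, which has the same parity.\<close>

lemma complement_unitrade:
  assumes "S \<in> unitrades n"
  shows "words n - S \<in> unitrades n"
  unfolding unitrades_iff
proof (intro conjI ballI)
  fix w i
  assume w: "w \<in> words n" "i \<in> {1..n}"
  have "{a \<in> Sigma4. w(i := a) \<in> words n - S} = Sigma4 - {a \<in> Sigma4. w(i := a) \<in> S}"
    using word_update[OF w] by auto
  moreover have "card (Sigma4 - {a \<in> Sigma4. w(i := a) \<in> S}) = 4 - card {a \<in> Sigma4. w(i := a) \<in> S}"
    by (subst card_Diff_subset) (auto simp: Sigma4_def)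
  moreover have "even (card {a \<in> Sigma4. w(i := a) \<in> S})"
    using assms w unfolding unitrades_iff by blast
  ultimately show "even (card {a \<in> Sigma4. w(i := a) \<in> words n - S})"
    by simp
qed auto

section \<open>Moves: coordinate permutations combined with isotopies\<close>

text \<open>The letters are permuted after the coordinates, opposite to the order in \<^const>\<open>equivalent\<close>;
  then the composition law \<open>move_mul\<close> involves no inverses.\<close>

definition moves :: "nat \<Rightarrow> ((nat \<Rightarrow> nat \<Rightarrow> nat) \<times> (nat \<Rightarrow> nat)) set" where
  "moves n = ({1..n} \<rightarrow>\<^sub>E {p. p permutes Sigma4}) \<times> {\<sigma>. \<sigma> permutes {1..n}}"

definition move :: "nat \<Rightarrow> (nat \<Rightarrow> nat \<Rightarrow> nat) \<times> (nat \<Rightarrow> nat) \<Rightarrow> (nat \<Rightarrow> nat) \<Rightarrow> nat \<Rightarrow> nat" where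
  "move n g w = (\<lambda>i\<in>{1..n}. fst g i (w (snd g i)))"

definition move_mul :: "nat \<Rightarrow> (nat \<Rightarrow> nat \<Rightarrow> nat) \<times> (nat \<Rightarrow> nat) \<Rightarrow>
    (nat \<Rightarrow> nat \<Rightarrow> nat) \<times> (nat \<Rightarrow> nat) \<Rightarrow> (nat \<Rightarrow> nat \<Rightarrow> nat) \<times> (nat \<Rightarrow> nat)" where
  "move_mul n h g = (\<lambda>i\<in>{1..n}. fst h i \<circ> fst g (snd h i), snd g \<circ> snd h)"

lemma finite_perms_Sigma4: "finite {p. p permutes Sigma4}"
  by (rule finite_permutations) (simp add: Sigma4_def)

lemma finite_moves: "finite (moves n)"
  unfolding moves_def
  by (intro finite_cartesian_product finite_PiE finite_perms_Sigma4 finite_permutations) auto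

lemma movesD:
  assumes "g \<in> moves n"
  shows "i \<in> {1..n} \<Longrightarrow> fst g i permutes Sigma4" "snd g permutes {1..n}"
    "i \<in> {1..n} \<Longrightarrow> snd g i \<in> {1..n}"
  using assms permutes_in_image[of "snd g" "{1..n}" i] by (auto simp: moves_def)

lemma move_in_words:
  assumes "g \<in> moves n" "w \<in> words n"
  shows "move n g w \<in> words n"
  unfolding words_def move_def
proof (rule restrict_PiE_iff[THEN iffD2], rule ballI)
  fix i assume i: "i \<in> {1..n}"
  have "w (snd g i) \<in> Sigma4"
    using assms(2) movesD(3)[OF assms(1) i] by (auto simp: words_def)
  then show "fst g i (w (snd g i)) \<in> Sigma4"
    using movesD(1)[OF assms(1) i] by (simp add: permutes_in_image)
qed

lemma inj_on_move:
  assumes g: "g \<in> moves n"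
  shows "inj_on (move n g) (words n)"
proof (rule inj_onI)
  fix v w
  assume vw: "v \<in> words n" "w \<in> words n" and eq: "move n g v = move n g w"
  have "v j = w j" if j: "j \<in> {1..n}" for j
  proof -
    obtain i where i: "i \<in> {1..n}" "snd g i = j"
      using movesD(2)[OF g] j by (metis permutes_image imageE)
    have "fst g i (v j) = fst g i (w j)"
      using fun_cong[OF eq, of i] i by (simp add: move_def)
    then show ?thesis
      using movesD(1)[OF g i(1)] by (metis permutes_inverses(2))
  qed
  then show "v = w"
    using vw unfolding words_def by (intro PiE_ext) auto
qed

lemma move_image_words: "g \<in> moves n \<Longrightarrow> move n g ` words n = words n"
  by (intro endo_inj_surj finite_words inj_on_move) (auto intro: move_in_words)

lemma move_mul_in_moves:
  assumes "h \<in> moves n" "g \<in> moves n"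
  shows "move_mul n h g \<in> moves n"
  using movesD[OF assms(1)] movesD[OF assms(2)]
  unfolding moves_def move_mul_def by (auto intro!: permutes_compose)

lemma move_move_mul:
  assumes "h \<in> moves n"
  shows "move n (move_mul n h g) = move n h \<circ> move n g"
  using movesD(3)[OF assms] by (auto simp: move_def move_mul_def fun_eq_iff)

lemma move_mul_image:
  "h \<in> moves n \<Longrightarrow> move n (move_mul n h g) ` S = move n h ` move n g ` S"
  by (simp only: move_move_mul image_comp)

text \<open>As \<open>snd h\<close> reaches every coordinate and each \<open>fst h i\<close> is
  injective, both components of \<open>g\<close> can be recovered from the product. This
  cancellation takes the place of group inverses in the orbit count.\<close>

lemma inj_on_move_mul:
  assumes h: "h \<in> moves n"
  shows "inj_on (move_mul n h) (moves n)"
proof (rule inj_onI)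
  fix g g'
  assume g: "g \<in> moves n" and g': "g' \<in> moves n" and eq: "move_mul n h g = move_mul n h g'"
  have "fst g j = fst g' j" if j: "j \<in> {1..n}" for j
  proof -
    obtain i where i: "i \<in> {1..n}" "snd h i = j"
      using movesD(2)[OF h] j by (metis permutes_image imageE)
    have "fst h i \<circ> fst g j = fst h i \<circ> fst g' j"
      using fun_cong[OF arg_cong[OF eq, of fst], of i] i by (simp add: move_mul_def)
    then show ?thesis
      using permutes_inj[OF movesD(1)[OF h i(1)]] by (simp add: fun_eq_iff inj_eq)
  qed
  then have "fst g = fst g'"
    using g g' unfolding moves_def mem_Times_iff by (metis PiE_ext)
  moreover have "snd g = snd g'"
    using arg_cong[OF eq, of snd] permutes_surj[OF movesD(2)[OF h]]
    by (auto simp: move_mul_def fun_eq_iff) (metis surjD)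
  ultimately show "g = g'"
    by (simp add: prod_eq_iff)
qed

text \<open>A move carries the line through \<open>u\<close> in direction \<open>snd g i\<close>
  onto the line through the image of \<open>u\<close> in direction \<open>i\<close>, renaming
  letters by \<open>fst g i\<close>; intersection sizes are preserved.\<close>

lemma move_image_unitrade:
  assumes g: "g \<in> moves n" and S: "S \<in> unitrades n"
  shows "move n g ` S \<in> unitrades n"
  unfolding unitrades_iff
proof (intro conjI ballI)
  show "move n g ` S \<subseteq> words n"
    using unitrades_subset[OF S] move_in_words[OF g] by blast
  fix w i
  assume w: "w \<in> words n" and i: "i \<in> {1..n}"
  define p where "p = fst g i"
  have p: "p permutes Sigma4"
    unfolding p_def using movesD(1)[OF g i] .
  obtain u where u: "u \<in> words n" "move n g u = w"
    using w imageE[of w "move n g" "words n"] by (simp add: move_image_words[OF g]) metis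
  have si: "snd g i \<in> {1..n}"
    using movesD(3)[OF g i] .
  have upd: "w(i := p a) = move n g (u(snd g i := a))" for a
  proof
    fix j
    show "(w(i := p a)) j = move n g (u(snd g i := a)) j"
      using u(2) i permutes_inj[OF movesD(2)[OF g]] by (auto simp: move_def p_def inj_eq)
  qed
  have mem: "w(i := p a) \<in> move n g ` S \<longleftrightarrow> u(snd g i := a) \<in> S" if "a \<in> Sigma4" for a
    unfolding upd using inj_on_move[OF g] unitrades_subset[OF S] word_update[OF u(1) si that]
    by (meson inj_on_image_mem_iff)
  have "{a \<in> Sigma4. w(i := a) \<in> move n g ` S} = p ` {a \<in> Sigma4. u(snd g i := a) \<in> S}"
  proof (intro set_eqI iffI)
    fix b assume b: "b \<in> {a \<in> Sigma4. w(i := a) \<in> move n g ` S}"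
    then obtain a where "a \<in> Sigma4" "b = p a"
      using p by (metis (no_types, lifting) mem_Collect_eq permutes_image imageE)
    then show "b \<in> p ` {a \<in> Sigma4. u(snd g i := a) \<in> S}"
      using b mem by auto
  qed (use p mem in \<open>auto simp: permutes_in_image\<close>)
  then have "card {a \<in> Sigma4. w(i := a) \<in> move n g ` S} = card {a \<in> Sigma4. u(snd g i := a) \<in> S}"
    using p by (simp add: card_image permutes_inj_on)
  then show "even (card {a \<in> Sigma4. w(i := a) \<in> move n g ` S})"
    using S u(1) si unfolding unitrades_iff by auto
qed

lemma move_image_complement:
  assumes "g \<in> moves n" "S \<subseteq> words n"
  shows "move n g ` (words n - S) = words n - move n g ` S"
  using inj_on_image_set_diff[OF inj_on_move[OF assms(1)], of "words n" S] assms
  by (simp add: move_image_words)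

lemma inj_on_image_move: "g \<in> moves n \<Longrightarrow> inj_on ((`) (move n g)) (unitrades n)"
  using inj_on_image_Pow[OF inj_on_move, of g n]
  by (rule inj_on_subset) (auto dest: unitrades_subset)

lemma bij_betw_image_move: "g \<in> moves n \<Longrightarrow> bij_betw ((`) (move n g)) (unitrades n) (unitrades n)"
  unfolding bij_betw_def
  by (intro conjI inj_on_image_move endo_inj_surj finite_unitrades) (auto intro: move_image_unitrade)

section \<open>Equivalence as the orbit relation of the moves\<close>

lemma equivalent_iff_move:
  "equivalent n S T \<longleftrightarrow> (\<exists>g\<in>moves n. move n g ` S = T)"
proof
  assume "equivalent n S T"
  then obtain \<theta> \<sigma> where \<theta>: "is_isotopy n \<theta>" and \<sigma>: "\<sigma> permutes {1..n}"
    and T: "coord_perm_image n \<sigma> (isotopy_image n \<theta> S) = T"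
    unfolding equivalent_def by blast
  \<comment> \<open>Position \<open>i\<close> takes its entry from position
    \<open>\<sigma> i\<close>, where the isotopy has already applied
    \<open>\<theta> (\<sigma> i)\<close>.\<close>
  define g where "g = ((\<lambda>i\<in>{1..n}. \<theta> (\<sigma> i)), \<sigma>)"
  have \<sigma>_in: "\<sigma> i \<in> {1..n}" if "i \<in> {1..n}" for i
    using that permutes_in_image[OF \<sigma>] by blast
  have "g \<in> moves n"
    using \<theta> \<sigma> \<sigma>_in unfolding g_def moves_def is_isotopy_def by auto
  moreover have "move n g ` S = T"
    unfolding T[symmetric] coord_perm_image_def isotopy_image_def image_image
    by (rule image_cong) (use \<sigma>_in in \<open>auto simp: move_def g_def fun_eq_iff\<close>)
  ultimately show "\<exists>g\<in>moves n. move n g ` S = T"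
    by blast
next
  assume "\<exists>g\<in>moves n. move n g ` S = T"
  then obtain g where g: "g \<in> moves n" and T: "move n g ` S = T"
    by blast
  define \<sigma> where "\<sigma> = snd g"
  have \<sigma>: "\<sigma> permutes {1..n}"
    unfolding \<sigma>_def by (rule movesD(2)[OF g])
  have \<sigma>_in: "\<sigma> i \<in> {1..n} \<longleftrightarrow> i \<in> {1..n}" for i
    by (rule permutes_in_image[OF \<sigma>])
  \<comment> \<open>Chosen so that \<open>\<theta> (\<sigma> i)\<close> becomes
    \<open>fst g i\<close>.\<close>
  define \<theta> where "\<theta> = (\<lambda>i. fst g (inv \<sigma> i))"
  have "is_isotopy n \<theta>"
    unfolding is_isotopy_def \<theta>_def
    using movesD(1)[OF g] permutes_in_image[OF permutes_inv[OF \<sigma>]] by blast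
  moreover have "coord_perm_image n \<sigma> (isotopy_image n \<theta> S) = T"
    unfolding T[symmetric] coord_perm_image_def isotopy_image_def image_image
    by (rule image_cong)
      (use \<sigma>_in in \<open>auto simp: move_def \<theta>_def fun_eq_iff permutes_inverses[OF \<sigma>] \<sigma>_def[symmetric]\<close>)
  ultimately show "equivalent n S T"
    unfolding equivalent_def using \<sigma> by blast
qed

lemma unitrade_equiv_eq:
  "unitrade_equiv n = {(S, T). S \<in> unitrades n \<and> T \<in> unitrades n \<and> (\<exists>g\<in>moves n. move n g ` S = T)}"
  unfolding unitrade_equiv_def equivalent_iff_move ..

lemma move_id:
  assumes "w \<in> words n"
  shows "move n (\<lambda>i\<in>{1..n}. id, id) w = w"
  using assms by (auto simp: move_def words_def fun_eq_iff PiE_iff extensional_def)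

lemma id_in_moves: "(\<lambda>i\<in>{1..n}. id, id) \<in> moves n"
  by (auto simp: moves_def permutes_id)

text \<open>Left multiplication by \<open>h\<close> is injective on the finite set of moves, hence surjective; this
  yields inverses without constructing them.\<close>

lemma ex_move_inverse:
  assumes h: "h \<in> moves n"
  shows "\<exists>g\<in>moves n. \<forall>w\<in>words n. move n g (move n h w) = w"
proof -
  have "move_mul n h ` moves n = moves n"
    by (intro endo_inj_surj finite_moves inj_on_move_mul h image_subsetI move_mul_in_moves)
  then have "(\<lambda>i\<in>{1..n}. id, id) \<in> move_mul n h ` moves n"
    using id_in_moves by blast
  then obtain g where g: "g \<in> moves n" "move_mul n h g = (\<lambda>i\<in>{1..n}. id, id)"
    by (elim imageE) simp
  have hg: "move n h (move n g w) = w" if "w \<in> words n" for w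
    using fun_cong[OF move_move_mul[OF h, of g], of w] g(2) move_id[OF that] by simp
  \<comment> \<open>Injectivity of \<open>h\<close> on words turns the right inverse
    \<open>g\<close> into a left inverse.\<close>
  have "move n g (move n h w) = w" if w: "w \<in> words n" for w
    using hg[OF move_in_words[OF h w]] inj_on_move[OF h] move_in_words[OF g(1)] move_in_words[OF h w] w
    by (meson inj_onD)
  then show ?thesis
    using g(1) by blast
qed

lemma equiv_unitrade_equiv: "equiv (unitrades n) (unitrade_equiv n)"
proof (rule equivI)
  show "refl_on (unitrades n) (unitrade_equiv n)"
  proof (rule refl_onI)
    fix S assume S: "S \<in> unitrades n"
    have "move n (\<lambda>i\<in>{1..n}. id, id) ` S = S"
      using move_id unitrades_subset[OF S] by (force simp: image_iff)
    then show "(S, S) \<in> unitrade_equiv n"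
      unfolding unitrade_equiv_eq using S id_in_moves by blast
  qed
  show "sym (unitrade_equiv n)"
  proof (rule symI)
    fix S T assume "(S, T) \<in> unitrade_equiv n"
    then obtain h where S: "S \<in> unitrades n" and T: "T \<in> unitrades n"
      and h: "h \<in> moves n" "move n h ` S = T"
      unfolding unitrade_equiv_eq by blast
    obtain g where g: "g \<in> moves n" "\<And>w. w \<in> words n \<Longrightarrow> move n g (move n h w) = w"
      using ex_move_inverse[OF h(1)] by blast
    have "move n g ` T = S"
      unfolding h(2)[symmetric] image_image using g(2) unitrades_subset[OF S]
      by (force simp: image_iff)
    then show "(T, S) \<in> unitrade_equiv n"
      unfolding unitrade_equiv_eq using S T g(1) by blast
  qed
  show "trans (unitrade_equiv n)"
  proof (rule transI)
    fix S T U assume "(S, T) \<in> unitrade_equiv n" "(T, U) \<in> unitrade_equiv n"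
    then obtain g h where *: "S \<in> unitrades n" "U \<in> unitrades n"
      "g \<in> moves n" "move n g ` S = T" "h \<in> moves n" "move n h ` T = U"
      unfolding unitrade_equiv_eq by blast
    then have "move n (move_mul n h g) ` S = U"
      by (simp only: move_mul_image)
    then show "(S, U) \<in> unitrade_equiv n"
      unfolding unitrade_equiv_eq using *(1,2) move_mul_in_moves[OF *(5,3)] by blast
  qed
qed (auto simp: unitrade_equiv_def)

section \<open>Unitrades sent to themselves or to their complements\<close>

definition opposite :: "nat \<Rightarrow> bool \<Rightarrow> (nat \<Rightarrow> nat) set \<Rightarrow> (nat \<Rightarrow> nat) set" where
  "opposite n b S = (if b then words n - S else S)"

definition fixed_count :: "nat \<Rightarrow> bool \<Rightarrow> (nat \<Rightarrow> nat \<Rightarrow> nat) \<times> (nat \<Rightarrow> nat) \<Rightarrow> nat" where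
  "fixed_count n b g = card {S \<in> unitrades n. move n g ` S = opposite n b S}"

lemma opposite_unitrade: "S \<in> unitrades n \<Longrightarrow> opposite n b S \<in> unitrades n"
  by (simp add: opposite_def complement_unitrade)

lemma move_image_opposite:
  "g \<in> moves n \<Longrightarrow> S \<subseteq> words n \<Longrightarrow> move n g ` opposite n b S = opposite n b (move n g ` S)"
  by (simp add: opposite_def move_image_complement)

text \<open>The orbit count with \<open>c = opposite n b\<close>: one Boolean covers both the number
  of all classes and the number of those stable under complementation.\<close>

lemma sum_fixed_count:
  "(\<Sum>g\<in>moves n. fixed_count n b g) =
     card (moves n) *
     card {C \<in> unitrades n // unitrade_equiv n. \<exists>S\<in>C. equivalent n S (opposite n b S)}"
proof -
  have "(\<Sum>g\<in>moves n. fixed_count n b g) =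
     card (moves n) *
     card {C \<in> unitrades n // unitrade_equiv n. \<exists>S\<in>C. (S, opposite n b S) \<in> unitrade_equiv n}"
    unfolding fixed_count_def
    by (rule twisted_orbit_count[OF finite_moves finite_unitrades move_mul_in_moves inj_on_move_mul
          move_image_unitrade move_mul_image unitrade_equiv_eq equiv_unitrade_equiv opposite_unitrade])
      (simp_all add: move_image_opposite unitrades_subset)
  moreover have "(S, opposite n b S) \<in> unitrade_equiv n \<longleftrightarrow> equivalent n S (opposite n b S)"
    if "C \<in> unitrades n // unitrade_equiv n" "S \<in> C" for C S
    using that in_quotient_imp_subset[OF equiv_unitrade_equiv] opposite_unitrade
    unfolding unitrade_equiv_def by blast
  then have "{C \<in> unitrades n // unitrade_equiv n. \<exists>S\<in>C. (S, opposite n b S) \<in> unitrade_equiv n} =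
      {C \<in> unitrades n // unitrade_equiv n. \<exists>S\<in>C. equivalent n S (opposite n b S)}"
    by blast
  ultimately show ?thesis
    by simp
qed

text \<open>The hypothesis \<open>eq\<close> states \<open>h g = g' h\<close> on words. Taking
  images under \<open>h\<close> matches the unitrades counted for \<open>g\<close> with those
  counted for \<open>g'\<close>, because \<open>h\<close> respects complements.\<close>

lemma fixed_count_conjugate:
  assumes h: "h \<in> moves n" and g: "g \<in> moves n"
    and eq: "\<And>w. w \<in> words n \<Longrightarrow> move n h (move n g w) = move n g' (move n h w)"
  shows "fixed_count n b g = fixed_count n b g'"
proof -
  have "move n g ` S = opposite n b S \<longleftrightarrow> move n g' ` move n h ` S = opposite n b (move n h ` S)"
    if S: "S \<in> unitrades n" for S
  proof -
    have "move n g ` S = opposite n b S \<longleftrightarrow> move n h ` move n g ` S = move n h ` opposite n b S"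
      using inj_on_image_move[OF h] move_image_unitrade[OF g S] opposite_unitrade[OF S]
      by (metis inj_onD)
    also have "move n h ` move n g ` S = move n g' ` move n h ` S"
      unfolding image_image using eq unitrades_subset[OF S] by (intro image_cong) auto
    also have "move n h ` opposite n b S = opposite n b (move n h ` S)"
      by (rule move_image_opposite[OF h unitrades_subset[OF S]])
    finally show ?thesis .
  qed
  then have "bij_betw ((`) (move n h)) {S \<in> unitrades n. move n g ` S = opposite n b S}
      {S \<in> unitrades n. move n g' ` S = opposite n b S}"
    by (intro bij_betw_Collect bij_betw_image_move h) simp
  then show ?thesis
    unfolding fixed_count_def by (rule bij_betw_same_card)
qed

text \<open>Conjugation by the isotopy \<open>H\<close> is twisted by \<open>\<sigma>\<close>: on
  the left of \<open>A i\<close> stands \<open>H i\<close>, on the right the inverse of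
  \<open>H (\<sigma> i)\<close>. This allows letter permutations to be shifted along the cycles of
  \<open>\<sigma>\<close>.\<close>

lemma fixed_count_isotopy:
  assumes "(H, id) \<in> moves n" "(A, \<sigma>) \<in> moves n"
    and "\<And>i. i \<in> {1..n} \<Longrightarrow> H i \<circ> A i = B i \<circ> H (\<sigma> i)"
  shows "fixed_count n b (A, \<sigma>) = fixed_count n b (B, \<sigma>)"
proof (rule fixed_count_conjugate[OF assms(1,2)])
  fix w
  have "H i (A i (w (\<sigma> i))) = B i (H (\<sigma> i) (w (\<sigma> i)))" if "i \<in> {1..n}" for i
    using fun_cong[OF assms(3)[OF that], of "w (\<sigma> i)"] by simp
  then show "move n (H, id) (move n (A, \<sigma>) w) = move n (B, \<sigma>) (move n (H, id) w)"
    using movesD(3)[OF assms(2)] by (auto simp: move_def fun_eq_iff)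
qed

text \<open>Conjugation by \<open>\<pi>\<close> reindexes the letter permutations and replaces
  \<open>\<sigma>\<close> by its conjugate \<open>\<sigma>'\<close>, which is specified by a
  commutation equation.\<close>

lemma fixed_count_coord_perm:
  assumes "\<pi> permutes {1..n}" "(A, \<sigma>) \<in> moves n" "\<sigma> \<circ> \<pi> = \<pi> \<circ> \<sigma>'"
  shows "fixed_count n b (A, \<sigma>) = fixed_count n b (\<lambda>i\<in>{1..n}. A (\<pi> i), \<sigma>')"
proof (rule fixed_count_conjugate[where h = "(\<lambda>i\<in>{1..n}. id, \<pi>)"])
  show "(\<lambda>i\<in>{1..n}. id, \<pi>) \<in> moves n"
    using assms(1) by (auto simp: moves_def)
  have \<pi>: "\<pi> i \<in> {1..n} \<longleftrightarrow> i \<in> {1..n}" for i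
    by (rule permutes_in_image[OF assms(1)])
  have "\<sigma>' i \<in> {1..n}" if "i \<in> {1..n}" for i
    using that fun_cong[OF assms(3), of i] \<pi> movesD(3)[OF assms(2)] by (metis comp_apply snd_conv)
  then show "move n (\<lambda>i\<in>{1..n}. id, \<pi>) (move n (A, \<sigma>) w) =
      move n (\<lambda>i\<in>{1..n}. A (\<pi> i), \<sigma>') (move n (\<lambda>i\<in>{1..n}. id, \<pi>) w)" for w
    using \<pi> fun_cong[OF assms(3)] by (auto simp: move_def fun_eq_iff)
qed (rule assms(2))

subsection \<open>Gaussian elimination over the two-element field\<close>

text \<open>A row of length \<open>n + 1\<close> encodes an affine equation over the two-element field in \<open>n\<close>
  unknowns; its last entry is multiplied by the parameter \<open>b\<close>, so that one elimination solves the
  homogeneous (\<open>b = False\<close>) and the inhomogeneous (\<open>b = True\<close>) system at once. Missing entries of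
  shorter rows count as zero.\<close>

fun row_value :: "bool \<Rightarrow> bool list \<Rightarrow> bool list \<Rightarrow> bool" where
  "row_value b [] x = False"
| "row_value b (c # r) [] = (c \<and> b)"
| "row_value b (c # r) (a # x) = ((c \<and> a) \<noteq> row_value b r x)"

fun row_add :: "bool list \<Rightarrow> bool list \<Rightarrow> bool list" where
  "row_add [] s = s"
| "row_add r [] = r"
| "row_add (False # r) (b # s) = b # row_add r s"
| "row_add (True # r) (False # s) = True # row_add r s"
| "row_add (True # r) (True # s) = False # row_add r s"

text \<open>The argument \<open>p\<close> is the pivot row without its leading entry. It is added to
  each row that contains the eliminated unknown, the leading column is dropped, and
  \<open>acc\<close> collects the results.\<close>

fun reduce :: "bool list \<Rightarrow> bool list list \<Rightarrow> bool list list \<Rightarrow> bool list list" where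
  "reduce p [] acc = acc"
| "reduce p ([] # rs) acc = reduce p rs acc"
| "reduce p ((False # r) # rs) acc = reduce p rs (r # acc)"
| "reduce p ((True # r) # rs) acc = reduce p rs (row_add p r # acc)"

text \<open>The first component tells whether the first unknown is determined by the others.\<close>

fun eliminate :: "bool list list \<Rightarrow> bool list list \<Rightarrow> bool \<times> bool list list" where
  "eliminate [] acc = (False, acc)"
| "eliminate ([] # rs) acc = eliminate rs acc"
| "eliminate ((False # r) # rs) acc = eliminate rs (r # acc)"
| "eliminate ((True # r) # rs) acc = (True, reduce r rs acc)"

text \<open>For use when no unknowns remain: the head of a row is then its constant entry, and a
  \<open>True\<close> there demands \<open>b = False\<close>.\<close>

fun consistent :: "bool list list \<Rightarrow> bool" where
  "consistent [] = True"
| "consistent ([] # rs) = consistent rs"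
| "consistent ((False # r) # rs) = consistent rs"
| "consistent ((True # r) # rs) = False"

text \<open>The result adds the dimension of the homogeneous solution space to \<open>d\<close> and tells whether the
  inhomogeneous system is solvable.\<close>

fun gauss :: "nat \<Rightarrow> nat \<Rightarrow> bool list list \<Rightarrow> nat \<times> bool" where
  "gauss d 0 rows = (d, consistent rows)"
| "gauss d (Suc n) rows =
    (case eliminate rows [] of (True, rs) \<Rightarrow> gauss d n rs | (False, rs) \<Rightarrow> gauss (Suc d) n rs)"

definition solutions :: "bool \<Rightarrow> nat \<Rightarrow> bool list list \<Rightarrow> bool list set" where
  "solutions b n rows = {x. length x = n \<and> (\<forall>r\<in>set rows. \<not> row_value b r x)}"

text \<open>The homogeneous system has the zero solution, so only \<open>b = True\<close> can give
  an empty solution set; otherwise the solutions form a coset of the homogeneous solution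
  space.\<close>

fun solution_count :: "bool \<Rightarrow> nat \<times> bool \<Rightarrow> nat" where
  "solution_count b (d, c) = (if b \<and> \<not> c then 0 else 2 ^ d)"

lemma row_value_row_add: "row_value b (row_add r s) x = (row_value b r x \<noteq> row_value b s x)"
  by (induction r s arbitrary: x rule: row_add.induct; case_tac x) auto

lemma row_value_append:
  "length r = length x \<Longrightarrow>
    row_value b (r @ s) (x @ y) = (row_value False r x \<noteq> row_value b s y)"
  by (induction r x rule: list_induct2) auto

text \<open>A row with leading \<open>True\<close> has as its value \<open>a\<close> plus the value
  of its tail; under the premise this is the value of the tail plus that of
  \<open>p\<close>.\<close>

lemma row_value_reduce:
  "a = row_value b p x \<Longrightarrow>
    (\<forall>r\<in>set (reduce p rs acc). \<not> row_value b r x) \<longleftrightarrow>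
    (\<forall>r\<in>set rs. \<not> row_value b r (a # x)) \<and> (\<forall>r\<in>set acc. \<not> row_value b r x)"
  by (induction p rs acc rule: reduce.induct) (auto simp: row_value_row_add)

text \<open>The first row with leading \<open>True\<close> serves as pivot: it holds exactly when
  \<open>a\<close> equals the value of its tail, and this value is substituted in the rows after
  it.\<close>

lemma eliminate_pivot:
  "eliminate rs acc = (True, rs') \<Longrightarrow>
    \<exists>p. \<forall>a x. (\<forall>r\<in>set rs. \<not> row_value b r (a # x)) \<and> (\<forall>r\<in>set acc. \<not> row_value b r x) \<longleftrightarrow>
      a = row_value b p x \<and> (\<forall>r\<in>set rs'. \<not> row_value b r x)"
proof (induction rs acc rule: eliminate.induct)
  case (4 r rs acc)
  then have "\<forall>a x. (\<forall>q\<in>set ((True # r) # rs). \<not> row_value b q (a # x)) \<and>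
      (\<forall>q\<in>set acc. \<not> row_value b q x) \<longleftrightarrow>
      a = row_value b r x \<and> (\<forall>r\<in>set rs'. \<not> row_value b r x)"
    using row_value_reduce[of _ b r _ rs acc] by auto
  then show ?case
    by blast
next
  case (3 r rs acc)
  have "(\<forall>q\<in>set ((False # r) # rs). \<not> row_value b q (a # x)) \<and> (\<forall>q\<in>set acc. \<not> row_value b q x) \<longleftrightarrow>
      (\<forall>q\<in>set rs. \<not> row_value b q (a # x)) \<and> (\<forall>q\<in>set (r # acc). \<not> row_value b q x)" for a x
    by auto
  then show ?case
    using 3 by (simp only: eliminate.simps)
qed simp_all

lemma eliminate_no_pivot:
  "eliminate rs acc = (False, rs') \<Longrightarrow>
    (\<forall>r\<in>set rs. \<not> row_value b r (a # x)) \<and> (\<forall>r\<in>set acc. \<not> row_value b r x) \<longleftrightarrow>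
      (\<forall>r\<in>set rs'. \<not> row_value b r x)"
  by (induction rs acc rule: eliminate.induct) auto

lemma consistent_iff: "consistent rs \<longleftrightarrow> (\<forall>r\<in>set rs. \<not> row_value True r [])"
  by (induction rs rule: consistent.induct) auto

text \<open>Induction on the number of unknowns: a pivot makes the first unknown a function of the
  others, while without a pivot it is free and doubles the count. The factor \<open>2 ^ d\<close>
  accounts for the accumulator of free unknowns.\<close>

lemma card_solutions_gauss:
  "2 ^ d * card (solutions b n rows) = solution_count b (gauss d n rows)"
proof (induction n arbitrary: d rows)
  case 0
  have "row_value False r [] = False" for r
    by (cases r) auto
  then have "solutions b 0 rows = (if b \<and> \<not> consistent rows then {} else {[]})"
    by (cases b) (auto simp: solutions_def consistent_iff)
  then show ?case
    by simp
next
  case (Suc n)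
  obtain pivot rs where e: "eliminate rows [] = (pivot, rs)"
    by fastforce
  have Cons: "x \<in> solutions b (Suc n) rows \<longleftrightarrow>
      (\<exists>a y. x = a # y \<and> length y = n \<and> (\<forall>r\<in>set rows. \<not> row_value b r (a # y)))" for x
    by (cases x) (auto simp: solutions_def)
  show ?case
  proof (cases pivot)
    case True
    then obtain p where p: "\<And>a x. (\<forall>r\<in>set rows. \<not> row_value b r (a # x)) \<longleftrightarrow>
        a = row_value b p x \<and> (\<forall>r\<in>set rs. \<not> row_value b r x)"
      using eliminate_pivot[of rows "[]" rs b] e by auto
    have "solutions b (Suc n) rows = (\<lambda>x. row_value b p x # x) ` solutions b n rs"
      by (rule set_eqI) (unfold Cons p, auto simp: solutions_def)
    then have "card (solutions b (Suc n) rows) = card (solutions b n rs)"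
      by (simp add: card_image inj_on_def)
    then show ?thesis
      using Suc[of d rs] e True by simp
  next
    case False
    have p: "(\<forall>r\<in>set rows. \<not> row_value b r (a # x)) \<longleftrightarrow> (\<forall>r\<in>set rs. \<not> row_value b r x)" for a x
      using eliminate_no_pivot[of rows "[]" rs b a x] e False by auto
    have "solutions b (Suc n) rows = (\<lambda>(a, x). a # x) ` (UNIV \<times> solutions b n rs)"
      by (rule set_eqI) (unfold Cons p, auto simp: solutions_def image_iff)
    then have "card (solutions b (Suc n) rows) = 2 * card (solutions b n rs)"
      by (simp add: card_image inj_on_def card_cartesian_product)
    then show ?thesis
      using Suc[of "Suc d" rs] e False by (simp add: ac_simps)
  qed
qed

subsection \<open>Coordinates on the unitrades in dimension three\<close>

definition triple :: "'a \<Rightarrow> 'a \<Rightarrow> 'a \<Rightarrow> nat \<Rightarrow> 'a" where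
  "triple a b c = (\<lambda>i\<in>{1..3}. if i = 1 then a else if i = 2 then b else c)"

lemma triple_apply [simp]:
  "triple a b c (Suc 0) = a" "triple a b c 2 = b" "triple a b c 3 = c"
  by (simp_all add: triple_def)

lemma atLeastAtMost_1_3: "{1..3} = {1, 2, 3 :: nat}"
  by auto

lemma PiE_triple:
  "{1..3 :: nat} \<rightarrow>\<^sub>E A = (\<lambda>(a, b, c). triple a b c) ` (A \<times> A \<times> A)"
proof (intro set_eqI iffI)
  fix f assume f: "f \<in> {1..3 :: nat} \<rightarrow>\<^sub>E A"
  have "f = triple (f 1) (f 2) (f 3)"
  proof (rule extensionalityI[of _ "{1..3}"])
    show "f \<in> extensional {1..3}"
      using f by (simp add: PiE_iff)
    fix i :: nat
    assume "i \<in> {1..3}"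
    then show "f i = triple (f 1) (f 2) (f 3) i"
      unfolding atLeastAtMost_1_3 by auto
  qed (simp add: triple_def)
  moreover have "f 1 \<in> A" "f 2 \<in> A" "f 3 \<in> A"
    using f by (auto simp: PiE_iff)
  ultimately show "f \<in> (\<lambda>(a, b, c). triple a b c) ` (A \<times> A \<times> A)"
    by force
qed (auto simp: triple_def)

lemma triple_eq_iff: "triple a b c = triple a' b' c' \<longleftrightarrow> a = a' \<and> b = b' \<and> c = c'"
  by (metis triple_apply)

lemma triple_upd:
  "(triple i j k)(1 := a) = triple a j k" "(triple i j k)(2 := a) = triple i a k"
  "(triple i j k)(3 := a) = triple i j a"
  by (auto simp: triple_def fun_eq_iff)

lemma Sigma4_iff: "i \<in> Sigma4 \<longleftrightarrow> i < 4"
  unfolding Sigma4_def by auto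

lemma words_3: "words 3 = (\<lambda>(i, j, k). triple i j k) ` (Sigma4 \<times> Sigma4 \<times> Sigma4)"
  unfolding words_def by (rule PiE_triple)

lemma triple_in_words: "triple i j k \<in> words 3 \<longleftrightarrow> i < 4 \<and> j < 4 \<and> k < 4"
  unfolding words_3 by (force simp: triple_eq_iff Sigma4_iff)

text \<open>A function on the alphabet with vanishing line sum is determined by its values
  at the letters 0, 1, 2.\<close>

definition spread :: "nat \<Rightarrow> (nat \<Rightarrow> bool) \<Rightarrow> bool" where
  "spread i f = (if i = 0 then f 0 else if i = 1 then f 1 else if i = 2 then f 2
    else (f 0 \<noteq> (f 1 \<noteq> f 2)))"

lemma spread_simps:
  "spread 0 f = f 0" "spread (Suc 0) f = f 1" "spread 2 f = f 2"
  "spread 3 f = (f 0 \<noteq> (f 1 \<noteq> f 2))"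
  by (simp_all add: spread_def)

lemma less_4_cases: "i < 4 \<Longrightarrow> i = 0 \<or> i = Suc 0 \<or> i = 2 \<or> i = (3 :: nat)"
  by auto

lemma even_card_Sigma4:
  "even (card {a \<in> Sigma4. P a}) \<longleftrightarrow> (P 3 = (P 0 \<noteq> (P 1 \<noteq> P 2)))"
proof -
  have insert: "{a \<in> insert x A. P a} = (if P x then insert x {a \<in> A. P a} else {a \<in> A. P a})"
    for x and A :: "nat set"
    by auto
  show ?thesis
    unfolding Sigma4_def insert by simp
qed

lemma unitrades_3_iff:
  "S \<in> unitrades 3 \<longleftrightarrow> S \<subseteq> words 3 \<and> (\<forall>i<4. \<forall>j<4. \<forall>k<4.
     (triple 3 j k \<in> S) = spread 3 (\<lambda>a. triple a j k \<in> S) \<and>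
     (triple i 3 k \<in> S) = spread 3 (\<lambda>a. triple i a k \<in> S) \<and>
     (triple i j 3 \<in> S) = spread 3 (\<lambda>a. triple i j a \<in> S))"
proof -
  have "(\<forall>w\<in>words 3. \<forall>i\<in>{1..3}. even (card {a \<in> Sigma4. w(i := a) \<in> S})) \<longleftrightarrow>
    (\<forall>i<4. \<forall>j<4. \<forall>k<4. even (card {a \<in> Sigma4. triple a j k \<in> S}) \<and>
       even (card {a \<in> Sigma4. triple i a k \<in> S}) \<and> even (card {a \<in> Sigma4. triple i j a \<in> S}))"
    unfolding words_3 atLeastAtMost_1_3 by (auto simp: triple_upd[simplified] Sigma4_iff)
  then show ?thesis
    unfolding unitrades_iff even_card_Sigma4 spread_simps by simp
qed

lemma spread_line:
  assumes "f 3 = spread 3 f" "i < 4"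
  shows "spread i f = f i"
  using less_4_cases[OF assms(2)] assms(1) by (auto simp: spread_simps)

text \<open>A nested equality of three bits is their sum over GF(2), so this is additivity of
  \<open>spread i\<close>. It moves the extension in one coordinate past the extension in
  another.\<close>

lemma spread_add3: "spread i (\<lambda>a. f a = (g a = h a)) = (spread i f = (spread i g = spread i h))"
  by (auto simp: spread_def)

section \<open>Cell membership as a linear form in 27 bits\<close>

fun kron :: "bool list \<Rightarrow> bool list \<Rightarrow> bool list" where
  "kron [] v = []"
| "kron (True # u) v = v @ kron u v"
| "kron (False # u) v = map (\<lambda>_. False) v @ kron u v"

definition letter_row :: "nat \<Rightarrow> bool list" where
  "letter_row i = (if i = 0 then [True, False, False] else if i = 1 then [False, True, False]
    else if i = 2 then [False, False, True] else [True, True, True])"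

text \<open>The extension to the letter 3 acts on each coordinate separately, so the coefficients of
  a cell in terms of the base cells form a Kronecker product of three letter vectors.\<close>

definition cell_row :: "nat \<times> nat \<times> nat \<Rightarrow> bool list" where
  "cell_row = (\<lambda>(i, j, k). kron (letter_row i) (kron (letter_row j) (letter_row k)))"

definition base_cells :: "(nat \<times> nat \<times> nat) list" where
  "base_cells = List.product [0, 1, 2] (List.product [0, 1, 2] [0, 1, 2])"

definition coords :: "(nat \<Rightarrow> nat) set \<Rightarrow> bool list" where
  "coords S = map (\<lambda>(i, j, k). triple i j k \<in> S) base_cells"

text \<open>The row of \<open>p\<close> says that the bits of the cells \<open>p\<close> and
  \<open>g p\<close> differ exactly when \<open>b\<close> holds; the final \<open>True\<close> is
  the coefficient of \<open>b\<close>. Base cells suffice, as they determine a unitrade.\<close>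

definition fix_rows :: "(nat \<times> nat \<times> nat \<Rightarrow> nat \<times> nat \<times> nat) \<Rightarrow> bool list list" where
  "fix_rows g = map (\<lambda>p. row_add (cell_row p) (cell_row (g p)) @ [True]) base_cells"

lemma row_value_zero: "row_value b (map (\<lambda>_. False) v) y = False"
  by (induction v arbitrary: y; case_tac y) auto

lemma row_value_zero_append: "row_value b (map (\<lambda>_. False) v @ r) (y @ x) = row_value b r x"
  if "length v = length y"
  using that by (induction v y rule: list_induct2) auto

text \<open>The argument is cut into three blocks, one for each of the letters 0, 1, 2; the outer
  factor selects one block or adds all three.\<close>

lemma row_value_letter_kron:
  assumes "length v = n" "length y0 = n" "length y1 = n" "length y2 = n"
  shows "row_value False (kron (letter_row i) v) (y0 @ y1 @ y2) =
    spread i (\<lambda>a. row_value False v ([y0, y1, y2] ! a))"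
  using assms row_value_append[of v y2 False "[]" "[]"]
  by (auto simp: letter_row_def spread_def row_value_append row_value_zero row_value_zero_append)

lemma row_value_letter:
  "row_value False (letter_row i) [y0, y1, y2] = spread i (\<lambda>a. [y0, y1, y2] ! a)"
  by (auto simp: letter_row_def spread_def)

lemma length_letter_row: "length (letter_row i) = 3"
  by (simp add: letter_row_def)

lemma length_kron: "length (kron u v) = length u * length v"
  by (induction u v rule: kron.induct) auto

lemma length_cell_row: "length (cell_row p) = 27"
  by (simp add: cell_row_def length_kron length_letter_row split: prod.split)

text \<open>The block rule peels off the coordinates: first blocks of length 9, then blocks of
  length 3, then single bits.\<close>

lemma row_value_cell:
  "row_value False (cell_row (i, j, k)) (map (\<lambda>(a, b, c). y a b c) base_cells) =
    spread i (\<lambda>a. spread j (\<lambda>b. spread k (\<lambda>c. y a b c)))"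
proof -
  define z where "z a b = [y a b 0, y a b 1, y a b 2]" for a b
  define q where "q a = z a 0 @ z a 1 @ z a 2" for a
  have lz: "length (z a b) = 3" for a b
    by (simp add: z_def)
  have lq: "length (q a) = 9" for a
    by (simp add: q_def lz)
  have x: "map (\<lambda>(a, b, c). y a b c) base_cells = q 0 @ q 1 @ q 2"
    by (simp add: base_cells_def z_def q_def)
  have z: "row_value False (letter_row k) (z a b) = spread k (\<lambda>c. y a b c)" for a b
    unfolding z_def row_value_letter by (simp add: spread_def)
  have q: "row_value False (kron (letter_row j) (letter_row k)) (q a) =
      spread j (\<lambda>b. spread k (\<lambda>c. y a b c))" for a
    unfolding q_def
    by (subst row_value_letter_kron[where n = 3]) (simp_all add: length_letter_row lz z spread_def[of j])
  show ?thesis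
    unfolding x cell_row_def prod.case
    by (subst row_value_letter_kron[where n = 9])
      (simp_all add: length_letter_row length_kron lq q spread_def[of i])
qed

text \<open>Vanishing line sums let \<open>spread\<close> be evaluated in the third coordinate, then
  in the second, then in the first.\<close>

lemma row_value_coords:
  assumes S: "S \<in> unitrades 3" and "i < 4" "j < 4" "k < 4"
  shows "row_value False (cell_row (i, j, k)) (coords S) \<longleftrightarrow> triple i j k \<in> S"
proof -
  have "spread k (\<lambda>c. triple a b c \<in> S) \<longleftrightarrow> triple a b k \<in> S" if "a < 4" "b < 4" for a b
    by (rule spread_line) (use S that assms in \<open>auto simp: unitrades_3_iff\<close>)
  moreover have "spread j (\<lambda>b. triple a b k \<in> S) \<longleftrightarrow> triple a j k \<in> S" if "a < 4" for a
    by (rule spread_line) (use S that assms in \<open>auto simp: unitrades_3_iff\<close>)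
  moreover have "spread i (\<lambda>a. triple a j k \<in> S) \<longleftrightarrow> triple i j k \<in> S"
    by (rule spread_line) (use S assms in \<open>auto simp: unitrades_3_iff\<close>)
  \<comment> \<open>Since \<open>spread\<close> reads only the letters 0, 1, 2, the inner extensions
    may be rewritten by facts about letters below 4.\<close>
  moreover have "spread l f = spread l g" if "\<And>a. a < 4 \<Longrightarrow> f a = g a" for l f g
    using that by (simp add: spread_def)
  ultimately show ?thesis
    unfolding coords_def row_value_cell by (smt (verit))
qed

lemma unitrade_eqI:
  assumes "S \<in> unitrades 3" "T \<in> unitrades 3" "coords S = coords T"
  shows "S = T"
proof -
  have "w \<in> S \<longleftrightarrow> w \<in> T" if "w \<in> words 3" for w
    using that assms row_value_coords[of S] row_value_coords[of T]
    unfolding words_3 by (auto simp: Sigma4_iff)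
  then show ?thesis
    using unitrades_subset assms(1,2) by blast
qed

lemma length_coords: "length (coords S) = 27"
  by (simp add: coords_def base_cells_def)

lemma ex_unitrade_coords:
  assumes "length x = 27"
  shows "\<exists>S\<in>unitrades 3. coords S = x"
proof -
  \<comment> \<open>\<open>9 * a + 3 * b + c\<close> is the position of \<open>(a, b, c)\<close> in
    \<open>base_cells\<close>, counted from 0.\<close>
  define y where "y a b c = x ! (9 * a + 3 * b + c)" for a b c
  \<comment> \<open>The prescribed bits are extended in all three coordinates; by
    \<open>spread_add3\<close> the line sums then vanish in every direction.\<close>
  define S where "S = {w \<in> words 3. spread (w 1) (\<lambda>a. spread (w 2) (\<lambda>b. spread (w 3) (\<lambda>c. y a b c)))}"
  have mem: "triple i j k \<in> S \<longleftrightarrow> spread i (\<lambda>a. spread j (\<lambda>b. spread k (\<lambda>c. y a b c)))"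
    if "i < 4" "j < 4" "k < 4" for i j k
    using that by (simp add: S_def triple_in_words)
  have "S \<in> unitrades 3"
    unfolding unitrades_3_iff
  proof (intro conjI allI impI)
    fix i j k :: nat
    assume "i < 4" "j < 4" "k < 4"
    then show "(triple 3 j k \<in> S) = spread 3 (\<lambda>a. triple a j k \<in> S)"
      "(triple i 3 k \<in> S) = spread 3 (\<lambda>a. triple i a k \<in> S)"
      "(triple i j 3 \<in> S) = spread 3 (\<lambda>a. triple i j a \<in> S)"
      by (simp_all add: mem spread_simps spread_add3)
  qed (simp add: S_def)
  moreover have "coords S = map (\<lambda>(a, b, c). y a b c) base_cells"
    by (simp add: coords_def base_cells_def mem spread_simps)
  moreover have "map (\<lambda>(a, b, c). y a b c) base_cells = x"
  proof -
    have "map (\<lambda>(a, b, c). y a b c) base_cells = map ((!) x) [0..<27]"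
      by (simp add: base_cells_def y_def upt_rec) (simp add: numeral_eq_Suc)
    then show ?thesis
      using map_nth[of x] assms by simp
  qed
  ultimately show ?thesis
    by metis
qed

lemma bij_betw_coords: "bij_betw coords (unitrades 3) {x. length x = 27}"
  unfolding bij_betw_def
proof (intro conjI inj_onI)
  show "coords ` unitrades 3 = {x. length x = 27}"
    using ex_unitrade_coords by (auto simp: length_coords image_iff)
qed (rule unitrade_eqI)

lemma card_unitrades_3: "card (unitrades 3) = 2 ^ 27"
  using bij_betw_same_card[OF bij_betw_coords] card_lists_length_eq[of "UNIV :: bool set" 27]
  by simp

text \<open>A unitrade is determined by its 27 bits, so the condition becomes the system
  \<open>fix_rows \<gamma>\<close>, where \<open>\<gamma>\<close> is the action of \<open>g\<close>
  on cells.\<close>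

lemma fixed_count_gauss:
  assumes g: "g \<in> moves 3"
    and \<gamma>: "\<And>i j k. i < 4 \<Longrightarrow> j < 4 \<Longrightarrow> k < 4 \<Longrightarrow>
      move 3 g (triple i j k) = (case \<gamma> (i, j, k) of (i', j', k') \<Rightarrow> triple i' j' k')"
  shows "fixed_count 3 b g = solution_count b (gauss 0 27 (fix_rows \<gamma>))"
proof -
  have "move 3 g ` S = opposite 3 b S \<longleftrightarrow> (\<forall>r\<in>set (fix_rows \<gamma>). \<not> row_value b r (coords S))"
    if S: "S \<in> unitrades 3" for S
  proof -
    define T where "T = opposite 3 b S"
    have T: "T \<in> unitrades 3"
      unfolding T_def by (rule opposite_unitrade[OF S])
    \<comment> \<open>The preimage \<open>S'\<close> of \<open>T\<close> under \<open>g\<close>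
      turns the condition into \<open>S = S'\<close>; at each cell this involves only the forward
      image of that cell.\<close>
    then obtain S' where S': "S' \<in> unitrades 3" "move 3 g ` S' = T"
      using bij_betw_image_move[OF g] unfolding bij_betw_def by (metis imageE)
    have mem: "move 3 g w \<in> T \<longleftrightarrow> w \<in> S'" if "w \<in> words 3" for w
      unfolding S'(2)[symmetric]
      by (rule inj_on_image_mem_iff[OF inj_on_move[OF g] that unitrades_subset[OF S'(1)]])
    have row: "\<not> row_value b (row_add (cell_row p) (cell_row (\<gamma> p)) @ [True]) (coords S) \<longleftrightarrow>
        (case p of (i, j, k) \<Rightarrow> triple i j k \<in> S \<longleftrightarrow> triple i j k \<in> S')"
      if p: "p \<in> set base_cells" for p
    proof -
      obtain i j k where ijk: "p = (i, j, k)" "i < 4" "j < 4" "k < 4"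
        using p unfolding base_cells_def by auto
      obtain i' j' k' where ijk': "\<gamma> p = (i', j', k')"
        by (metis prod_cases3)
      have m: "move 3 g (triple i j k) = triple i' j' k'"
        using \<gamma>[OF ijk(2-)] ijk' ijk(1) by simp
      have w: "triple i j k \<in> words 3"
        using ijk by (simp add: triple_in_words)
      have w': "triple i' j' k' \<in> words 3"
        using move_in_words[OF g w] m by simp
      \<comment> \<open>The sum of two rows keeps length 27, so the appended \<open>True\<close>
        falls just behind the unknowns and multiplies \<open>b\<close>.\<close>
      have "length (row_add r s) = max (length r) (length s)" for r s
        by (induction r s rule: row_add.induct) auto
      then have "row_value b (row_add (cell_row p) (cell_row (\<gamma> p)) @ [True]) (coords S) =
          (row_value False (row_add (cell_row p) (cell_row (\<gamma> p))) (coords S) \<noteq> b)"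
        using row_value_append[of "row_add (cell_row p) (cell_row (\<gamma> p))" "coords S" b "[True]" "[]"]
        by (simp add: length_cell_row length_coords)
      also have "\<dots> = (((triple i j k \<in> S) \<noteq> (triple i' j' k' \<in> S)) \<noteq> b)"
        using row_value_coords[OF S, of i j k] row_value_coords[OF S, of i' j' k'] ijk ijk' w'
        by (simp add: row_value_row_add triple_in_words)
      also have "triple i' j' k' \<in> S \<longleftrightarrow> (triple i' j' k' \<in> T) \<noteq> b"
        using w' unitrades_subset[OF S] unfolding T_def opposite_def by auto
      also have "triple i' j' k' \<in> T \<longleftrightarrow> triple i j k \<in> S'"
        using mem[OF w] m by simp
      finally show ?thesis
        using ijk(1) by auto
    qed
    have "move 3 g ` S = T \<longleftrightarrow> S = S'"
      using S'  inj_on_image_move[OF g] S by (metis inj_onD)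
    also have "\<dots> \<longleftrightarrow> coords S = coords S'"
      using unitrade_eqI[OF S S'(1)] by blast
    also have "\<dots> \<longleftrightarrow> (\<forall>r\<in>set (fix_rows \<gamma>). \<not> row_value b r (coords S))"
      unfolding fix_rows_def using row by (auto simp: coords_def)
    finally show ?thesis
      unfolding T_def .
  qed
  then have "bij_betw coords {S \<in> unitrades 3. move 3 g ` S = opposite 3 b S}
      {x \<in> {x. length x = 27}. \<forall>r\<in>set (fix_rows \<gamma>). \<not> row_value b r x}"
    by (intro bij_betw_Collect bij_betw_coords) simp
  then have "fixed_count 3 b g = card (solutions b 27 (fix_rows \<gamma>))"
    unfolding fixed_count_def solutions_def by (simp add: bij_betw_same_card)
  then show ?thesis
    using card_solutions_gauss[of 0 b 27 "fix_rows \<gamma>"] by simp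
qed

subsection \<open>Summation over conjugacy classes\<close>

definition cycle_2 :: "nat \<Rightarrow> nat" where
  "cycle_2 = transpose 0 1"

definition cycle_2_2 :: "nat \<Rightarrow> nat" where
  "cycle_2_2 = transpose 0 1 \<circ> transpose 2 3"

definition cycle_3 :: "nat \<Rightarrow> nat" where
  "cycle_3 = transpose 0 1 \<circ> transpose 1 2"

definition cycle_4 :: "nat \<Rightarrow> nat" where
  "cycle_4 = transpose 0 1 \<circ> (transpose 1 2 \<circ> transpose 2 3)"

text \<open>One representative of each conjugacy class of the symmetric group on four letters;
  \<open>class_sizes\<close> follows this order.\<close>

definition cycle_types :: "(nat \<Rightarrow> nat) list" where
  "cycle_types = [id, cycle_2, cycle_2_2, cycle_3, cycle_4]"

definition class_sizes :: "nat list" where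
  "class_sizes = [1, 6, 3, 8, 6]"

definition weighted_sum :: "nat list \<Rightarrow> 'a list \<Rightarrow> ('a \<Rightarrow> nat) \<Rightarrow> nat" where
  "weighted_sum ws xs f = (\<Sum>(w, x)\<leftarrow>zip ws xs. w * f x)"

definition weight_product :: "nat list \<Rightarrow> nat list \<Rightarrow> nat list" where
  "weight_product us vs = map (\<lambda>(u, v). u * v) (List.product us vs)"

lemma weighted_sum_map: "weighted_sum ws (map h xs) f = weighted_sum ws xs (\<lambda>x. f (h x))"
  by (simp add: weighted_sum_def zip_map2 o_def case_prod_unfold)

text \<open>Nested class sums become one sum over a flat list, the form in which the elimination
  results are tabulated.\<close>

lemma weighted_sum_product:
  assumes "length us = length xs" "length vs = length ys"
  shows "weighted_sum us xs (\<lambda>x. weighted_sum vs ys (\<lambda>y. f (x, y))) =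
    weighted_sum (weight_product us vs) (List.product xs ys) f"
proof -
  have row: "(\<Sum>(w, z)\<leftarrow>zip (map ((*) u) vs) (map (Pair x) ys). w * f z) =
      u * (\<Sum>(v, y)\<leftarrow>zip vs ys. v * f (x, y))" for u x
    using assms(2) by (induction vs ys rule: list_induct2) (auto simp: algebra_simps)
  show ?thesis
    using assms(1) unfolding weighted_sum_def weight_product_def
    by (induction us xs rule: list_induct2) (simp_all add: row assms(2) o_def)
qed

abbreviation class_sum :: "((nat \<Rightarrow> nat) \<Rightarrow> nat) \<Rightarrow> nat" where
  "class_sum \<equiv> weighted_sum class_sizes cycle_types"

lemma length_cycle_types: "length class_sizes = length cycle_types"
  by (simp add: class_sizes_def cycle_types_def)

abbreviation S4 :: "(nat \<Rightarrow> nat) set" where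
  "S4 \<equiv> {p. p permutes Sigma4}"

lemma sum_S4_classes:
  fixes f :: "(nat \<Rightarrow> nat) \<Rightarrow> nat"
  assumes conj: "\<And>h p q. h permutes Sigma4 \<Longrightarrow> p permutes Sigma4 \<Longrightarrow> q permutes Sigma4 \<Longrightarrow>
    h \<circ> p = q \<circ> h \<Longrightarrow> f p = f q"
  shows "sum f S4 = class_sum f"
proof -
  have "transpose a b permutes Sigma4" if "a < 4" "b < 4" for a b
    using that by (simp add: permutes_swap_id Sigma4_iff)
  note perm = this permutes_compose fun_eq_iff transpose_def
    cycle_2_def cycle_2_2_def cycle_3_def cycle_4_def
  \<comment> \<open>Expansion over \<open>insert\<close> writes the 24 permutations as products of
    transpositions. Nineteen of them are not among the representatives; each is conjugated to its
    representative by an explicit \<open>h\<close>.\<close>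
  have "f (transpose 2 3) = f cycle_2"
    by (rule conj[of "transpose 0 2 \<circ> transpose 1 3"]) (auto simp: perm)
  moreover have "f (transpose 1 2) = f cycle_2"
    by (rule conj[of "transpose 0 2"]) (auto simp: perm)
  moreover have "f (transpose 1 3) = f cycle_2"
    by (rule conj[of "transpose 0 3"]) (auto simp: perm)
  moreover have "f (transpose 0 2) = f cycle_2"
    by (rule conj[of "transpose 1 2"]) (auto simp: perm)
  moreover have "f (transpose 0 3) = f cycle_2"
    by (rule conj[of "transpose 1 3"]) (auto simp: perm)
  moreover have "f (transpose 0 2 \<circ> transpose 1 3) = f cycle_2_2"
    by (rule conj[of "transpose 1 2"]) (auto simp: perm)
  moreover have "f (transpose 0 3 \<circ> transpose 1 2) = f cycle_2_2"
    by (rule conj[of "transpose 1 3"]) (auto simp: perm)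
  moreover have "f (transpose 1 2 \<circ> transpose 2 3) = f cycle_3"
    by (rule conj[of "transpose 0 3"]) (auto simp: perm)
  moreover have "f (transpose 1 3 \<circ> transpose 2 3) = f cycle_3"
    by (rule conj[of "transpose 0 3 \<circ> transpose 2 3"]) (auto simp: perm)
  moreover have "f (transpose 0 1 \<circ> transpose 1 3) = f cycle_3"
    by (rule conj[of "transpose 2 3"]) (auto simp: perm)
  moreover have "f (transpose 0 2 \<circ> transpose 2 3) = f cycle_3"
    by (rule conj[of "transpose 1 3 \<circ> transpose 2 3"]) (auto simp: perm)
  moreover have "f (transpose 0 2 \<circ> transpose 1 2) = f cycle_3"
    by (rule conj[of "transpose 1 2"]) (auto simp: perm)
  moreover have "f (transpose 0 3 \<circ> transpose 2 3) = f cycle_3"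
    by (rule conj[of "transpose 1 3"]) (auto simp: perm)
  moreover have "f (transpose 0 3 \<circ> transpose 1 3) = f cycle_3"
    by (rule conj[of "transpose 1 2 \<circ> transpose 2 3"]) (auto simp: perm)
  moreover have "f (transpose 0 1 \<circ> (transpose 1 3 \<circ> transpose 2 3)) = f cycle_4"
    by (rule conj[of "transpose 2 3"]) (auto simp: perm)
  moreover have "f (transpose 0 2 \<circ> (transpose 1 2 \<circ> transpose 2 3)) = f cycle_4"
    by (rule conj[of "transpose 0 1"]) (auto simp: perm)
  moreover have "f (transpose 0 2 \<circ> (transpose 1 3 \<circ> transpose 2 3)) = f cycle_4"
    by (rule conj[of "transpose 1 2"]) (auto simp: perm)
  moreover have "f (transpose 0 3 \<circ> (transpose 1 2 \<circ> transpose 2 3)) = f cycle_4"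
    by (rule conj[of "transpose 0 3"]) (auto simp: perm)
  moreover have "f (transpose 0 3 \<circ> (transpose 1 3 \<circ> transpose 2 3)) = f cycle_4"
    by (rule conj[of "transpose 1 3"]) (auto simp: perm)
  ultimately show ?thesis
    unfolding Sigma4_def weighted_sum_def class_sizes_def cycle_types_def
    by (simp add: sum_over_permutations_insert cycle_2_def cycle_2_2_def cycle_3_def cycle_4_def)
qed

lemma cycle_types_S4: "set cycle_types \<subseteq> S4"
  unfolding cycle_types_def cycle_2_def cycle_2_2_def cycle_3_def cycle_4_def
  by (auto intro!: permutes_compose permutes_swap_id permutes_id simp: Sigma4_def)

lemma card_S4: "card S4 = 24"
  by (subst card_permutations[of _ 4]) (simp_all add: Sigma4_def fact_numeral)

lemma moves_3:
  "moves 3 = (\<lambda>(\<sigma>, a, b, c). (triple a b c, \<sigma>)) ` ({\<sigma>. \<sigma> permutes {1..3}} \<times> S4 \<times> S4 \<times> S4)"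
  unfolding moves_def PiE_triple by force

lemma triple_in_moves:
  "(triple a b c, \<sigma>) \<in> moves 3 \<longleftrightarrow> a \<in> S4 \<and> b \<in> S4 \<and> c \<in> S4 \<and> \<sigma> permutes {1..3}"
  unfolding moves_3 by (force simp: triple_eq_iff)

lemma inj_triple_move: "inj_on (\<lambda>(\<sigma>, a, b, c). (triple a b c, \<sigma>)) A"
  by (auto simp: inj_on_def triple_eq_iff)

lemma card_moves_3: "card (moves 3) = 82944"
proof -
  have "card {\<sigma>. \<sigma> permutes {1..3 :: nat}} = 6"
    by (subst card_permutations[of _ 3]) (simp_all add: fact_numeral)
  then show ?thesis
    unfolding moves_3 by (simp add: card_image[OF inj_triple_move] card_cartesian_product card_S4)
qed

lemma sum_moves_3:
  "sum F (moves 3) = (\<Sum>\<sigma> | \<sigma> permutes {1..3}. \<Sum>a\<in>S4. \<Sum>b\<in>S4. \<Sum>c\<in>S4. F (triple a b c, \<sigma>))"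
  unfolding moves_3
  by (subst sum.reindex[OF inj_triple_move]) (simp add: sum.cartesian_product case_prod_unfold o_def)

lemma move_triple:
  "move 3 (triple a b c, \<sigma>) w = triple (a (w (\<sigma> 1))) (b (w (\<sigma> 2))) (c (w (\<sigma> 3)))"
proof
  fix i :: nat
  have "i = 1 \<or> i = 2 \<or> i = 3" if "i \<in> {1..3}"
    using that unfolding atLeastAtMost_1_3 by simp
  then show "move 3 (triple a b c, \<sigma>) w i = triple (a (w (\<sigma> 1))) (b (w (\<sigma> 2))) (c (w (\<sigma> 3))) i"
    by (cases "i \<in> {1..3}") (auto simp: move_def triple_def)
qed

lemma fixed_count_isotopy_3:
  assumes "a1 \<in> S4" "a2 \<in> S4" "a3 \<in> S4" "h1 \<in> S4" "h2 \<in> S4" "h3 \<in> S4" "\<sigma> permutes {1..3}"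
    and "h1 \<circ> a1 = b1 \<circ> triple h1 h2 h3 (\<sigma> 1)" "h2 \<circ> a2 = b2 \<circ> triple h1 h2 h3 (\<sigma> 2)"
      "h3 \<circ> a3 = b3 \<circ> triple h1 h2 h3 (\<sigma> 3)"
  shows "fixed_count 3 b (triple a1 a2 a3, \<sigma>) = fixed_count 3 b (triple b1 b2 b3, \<sigma>)"
proof (rule fixed_count_isotopy[where H = "triple h1 h2 h3"])
  show "triple h1 h2 h3 i \<circ> triple a1 a2 a3 i = triple b1 b2 b3 i \<circ> triple h1 h2 h3 (\<sigma> i)"
    if "i \<in> {1..3}" for i
    using that assms unfolding atLeastAtMost_1_3 by auto
qed (use assms in \<open>auto simp: triple_in_moves permutes_id\<close>)

lemma fixed_count_coord_perm_3:
  assumes "\<pi> permutes {1..3}" "a1 \<in> S4" "a2 \<in> S4" "a3 \<in> S4" "\<sigma> permutes {1..3}" "\<sigma> \<circ> \<pi> = \<pi> \<circ> \<sigma>'"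
  shows "fixed_count 3 b (triple a1 a2 a3, \<sigma>) =
    fixed_count 3 b (triple (triple a1 a2 a3 (\<pi> 1)) (triple a1 a2 a3 (\<pi> 2)) (triple a1 a2 a3 (\<pi> 3)), \<sigma>')"
proof -
  have "(\<lambda>i\<in>{1..3}. triple a1 a2 a3 (\<pi> i)) =
      triple (triple a1 a2 a3 (\<pi> 1)) (triple a1 a2 a3 (\<pi> 2)) (triple a1 a2 a3 (\<pi> 3))"
    unfolding triple_def[of "triple a1 a2 a3 (\<pi> 1)"]
    by (rule restrict_ext) (unfold atLeastAtMost_1_3, auto)
  then show ?thesis
    using fixed_count_coord_perm[of \<pi> 3 "triple a1 a2 a3" \<sigma> \<sigma>' b] assms by (simp add: triple_in_moves)
qed

section \<open>One coordinate permutation for each cycle type\<close>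

definition swap_12 :: "nat \<Rightarrow> nat" where
  "swap_12 = transpose 1 2"

definition rot_123 :: "nat \<Rightarrow> nat" where
  "rot_123 = transpose 1 2 \<circ> transpose 2 3"

lemma swap_12_simps: "swap_12 1 = 2" "swap_12 (Suc 0) = 2" "swap_12 2 = 1" "swap_12 3 = 3"
  by (simp_all add: swap_12_def transpose_def)

lemma rot_123_simps: "rot_123 1 = 2" "rot_123 (Suc 0) = 2" "rot_123 2 = 3" "rot_123 3 = 1"
  by (simp_all add: rot_123_def transpose_def)

lemma coord_perms:
  "swap_12 permutes {1..3}" "rot_123 permutes {1..3}"
  "transpose 2 3 permutes {1..3 :: nat}" "transpose 1 3 permutes {1..3 :: nat}"
  "transpose 1 3 \<circ> transpose 2 3 permutes {1..3 :: nat}"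
  unfolding swap_12_def rot_123_def by (auto intro!: permutes_compose permutes_swap_id)

lemma sum_coord_perms:
  fixes f :: "(nat \<Rightarrow> nat) \<Rightarrow> nat"
  shows "(\<Sum>\<sigma> | \<sigma> permutes {1..3}. f \<sigma>) =
    f id + f swap_12 + f (transpose 1 3) + f (transpose 2 3) + f rot_123 + f (transpose 1 3 \<circ> transpose 2 3)"
  unfolding atLeastAtMost_1_3 swap_12_def rot_123_def
  by (simp add: sum_over_permutations_insert)

text \<open>The three transpositions of coordinates are conjugate, and so are the two 3-cycles.
  Conjugation rearranges the letter permutations, which the sum over all triples absorbs.\<close>

lemma sum_fixed_count_moves_3:
  "(\<Sum>g\<in>moves 3. fixed_count 3 b g) =
     (\<Sum>p\<in>S4. \<Sum>q\<in>S4. \<Sum>r\<in>S4. fixed_count 3 b (triple p q r, id)) +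
     3 * (\<Sum>p\<in>S4. \<Sum>q\<in>S4. \<Sum>r\<in>S4. fixed_count 3 b (triple p q r, swap_12)) +
     2 * (\<Sum>p\<in>S4. \<Sum>q\<in>S4. \<Sum>r\<in>S4. fixed_count 3 b (triple p q r, rot_123))"
proof -
  have 13: "fixed_count 3 b (triple p q r, transpose 1 3) = fixed_count 3 b (triple p r q, swap_12)"
    if "p \<in> S4" "q \<in> S4" "r \<in> S4" for p q r
    by (subst fixed_count_coord_perm_3[where \<pi> = "transpose 2 3" and \<sigma>' = swap_12])
      (use that coord_perms in \<open>auto simp: swap_12_def fun_eq_iff transpose_def\<close>)
  have 23: "fixed_count 3 b (triple p q r, transpose 2 3) = fixed_count 3 b (triple r q p, swap_12)"
    if "p \<in> S4" "q \<in> S4" "r \<in> S4" for p q r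
    by (subst fixed_count_coord_perm_3[where \<pi> = "transpose 1 3" and \<sigma>' = swap_12])
      (use that coord_perms in \<open>auto simp: swap_12_def fun_eq_iff transpose_def\<close>)
  have 132: "fixed_count 3 b (triple p q r, transpose 1 3 \<circ> transpose 2 3) =
      fixed_count 3 b (triple p r q, rot_123)"
    if "p \<in> S4" "q \<in> S4" "r \<in> S4" for p q r
    by (subst fixed_count_coord_perm_3[where \<pi> = "transpose 2 3" and \<sigma>' = rot_123])
      (use that coord_perms in \<open>auto simp: rot_123_def fun_eq_iff transpose_def\<close>)
  have swap: "(\<Sum>p\<in>S4. \<Sum>q\<in>S4. \<Sum>r\<in>S4. F p r q) = (\<Sum>p\<in>S4. \<Sum>q\<in>S4. \<Sum>r\<in>S4. F p q r)"
    for F :: "_ \<Rightarrow> _ \<Rightarrow> _ \<Rightarrow> nat"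
    by (intro sum.cong refl sum.swap)
  have rev: "(\<Sum>p\<in>S4. \<Sum>q\<in>S4. \<Sum>r\<in>S4. F r q p) = (\<Sum>p\<in>S4. \<Sum>q\<in>S4. \<Sum>r\<in>S4. F p q r)"
    for F :: "_ \<Rightarrow> _ \<Rightarrow> _ \<Rightarrow> nat"
  proof -
    have "(\<Sum>p\<in>S4. \<Sum>q\<in>S4. \<Sum>r\<in>S4. F r q p) = (\<Sum>q\<in>S4. \<Sum>r\<in>S4. \<Sum>p\<in>S4. F r q p)"
      by (subst sum.swap) (intro sum.cong refl sum.swap)
    also have "\<dots> = (\<Sum>r\<in>S4. \<Sum>q\<in>S4. \<Sum>p\<in>S4. F r q p)"
      by (rule sum.swap)
    finally show ?thesis .
  qed
  have "(\<Sum>p\<in>S4. \<Sum>q\<in>S4. \<Sum>r\<in>S4. fixed_count 3 b (triple p q r, transpose 1 3)) =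
      (\<Sum>p\<in>S4. \<Sum>q\<in>S4. \<Sum>r\<in>S4. fixed_count 3 b (triple p r q, swap_12))"
    by (intro sum.cong refl 13)
  moreover have "(\<Sum>p\<in>S4. \<Sum>q\<in>S4. \<Sum>r\<in>S4. fixed_count 3 b (triple p q r, transpose 2 3)) =
      (\<Sum>p\<in>S4. \<Sum>q\<in>S4. \<Sum>r\<in>S4. fixed_count 3 b (triple r q p, swap_12))"
    by (intro sum.cong refl 23)
  moreover have "(\<Sum>p\<in>S4. \<Sum>q\<in>S4. \<Sum>r\<in>S4.
        fixed_count 3 b (triple p q r, transpose 1 3 \<circ> transpose 2 3)) =
      (\<Sum>p\<in>S4. \<Sum>q\<in>S4. \<Sum>r\<in>S4. fixed_count 3 b (triple p r q, rot_123))"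
    by (intro sum.cong refl 132)
  ultimately show ?thesis
    unfolding sum_moves_3 sum_coord_perms
    using swap[of "\<lambda>p q r. fixed_count 3 b (triple p q r, swap_12)"]
      swap[of "\<lambda>p q r. fixed_count 3 b (triple p q r, rot_123)"]
      rev[of "\<lambda>p q r. fixed_count 3 b (triple p q r, swap_12)"]
    by simp
qed

lemma id_S4: "id \<in> S4" and inv_S4: "p \<in> S4 \<Longrightarrow> inv p \<in> S4"
  and comp_S4: "p \<in> S4 \<Longrightarrow> q \<in> S4 \<Longrightarrow> p \<circ> q \<in> S4"
  by (auto intro: permutes_id permutes_inv permutes_compose)

lemma inv_comp_S4: "p \<in> S4 \<Longrightarrow> inv p \<circ> p = id" "p \<in> S4 \<Longrightarrow> p \<circ> inv p = id"
  by (auto intro: permutes_inv_o)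

text \<open>Conjugation by \<open>inv q\<close> in coordinate 2 shifts \<open>q\<close> along the
  transposition and leaves \<open>p \<circ> q\<close> in coordinate 1. For fixed \<open>q\<close>
  this product runs over \<open>S4\<close> as \<open>p\<close> does, so the 24 choices of
  \<open>q\<close> contribute equally.\<close>

lemma sum_fixed_count_swap:
  "(\<Sum>p\<in>S4. \<Sum>q\<in>S4. \<Sum>r\<in>S4. fixed_count 3 b (triple p q r, swap_12)) =
    24 * (\<Sum>p\<in>S4. \<Sum>r\<in>S4. fixed_count 3 b (triple p id r, swap_12))"
proof -
  have "fixed_count 3 b (triple p q r, swap_12) = fixed_count 3 b (triple (p \<circ> q) id r, swap_12)"
    if "p \<in> S4" "q \<in> S4" "r \<in> S4" for p q r
    by (rule fixed_count_isotopy_3[where ?h1.0 = id and ?h2.0 = "inv q" and ?h3.0 = id])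
      (use that coord_perms in \<open>simp_all add: swap_12_simps id_S4[simplified] inv_S4[simplified]
        comp_assoc inv_comp_S4\<close>)
  then have "(\<Sum>p\<in>S4. \<Sum>q\<in>S4. \<Sum>r\<in>S4. fixed_count 3 b (triple p q r, swap_12)) =
      (\<Sum>p\<in>S4. \<Sum>q\<in>S4. \<Sum>r\<in>S4. fixed_count 3 b (triple (p \<circ> q) id r, swap_12))"
    by (intro sum.cong refl) blast
  also have "\<dots> = (\<Sum>q\<in>S4. \<Sum>p\<in>S4. \<Sum>r\<in>S4. fixed_count 3 b (triple (p \<circ> q) id r, swap_12))"
    by (rule sum.swap)
  also have "\<dots> = (\<Sum>q\<in>S4. \<Sum>p\<in>S4. \<Sum>r\<in>S4. fixed_count 3 b (triple p id r, swap_12))"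
    by (intro sum.cong refl sum_permutations_compose_right[symmetric]) simp
  finally show ?thesis
    by (simp add: card_S4)
qed

text \<open>The same shift around the 3-cycle collects \<open>p \<circ> (q \<circ> r)\<close> in
  coordinate 1; \<open>576 = 24 ^ 2\<close> counts the choices of \<open>q\<close> and
  \<open>r\<close>.\<close>

lemma sum_fixed_count_rot:
  "(\<Sum>p\<in>S4. \<Sum>q\<in>S4. \<Sum>r\<in>S4. fixed_count 3 b (triple p q r, rot_123)) =
    576 * (\<Sum>p\<in>S4. fixed_count 3 b (triple p id id, rot_123))"
proof -
  have "fixed_count 3 b (triple p q r, rot_123) = fixed_count 3 b (triple (p \<circ> (q \<circ> r)) id id, rot_123)"
    if "p \<in> S4" "q \<in> S4" "r \<in> S4" for p q r
  proof -
    have "q \<circ> (r \<circ> (inv r \<circ> inv q)) = q \<circ> ((r \<circ> inv r) \<circ> inv q)"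
      by (simp only: comp_assoc)
    then have "q \<circ> (r \<circ> (inv r \<circ> inv q)) = id"
      using that by (simp add: inv_comp_S4)
    then show ?thesis
      by (intro fixed_count_isotopy_3[where ?h1.0 = id and ?h2.0 = "inv r \<circ> inv q" and ?h3.0 = "inv r"])
        (use that coord_perms in \<open>simp_all add: rot_123_simps id_S4[simplified] inv_S4[simplified]
          comp_S4[simplified] comp_assoc inv_comp_S4\<close>)
  qed
  then have "(\<Sum>p\<in>S4. \<Sum>q\<in>S4. \<Sum>r\<in>S4. fixed_count 3 b (triple p q r, rot_123)) =
      (\<Sum>p\<in>S4. \<Sum>q\<in>S4. \<Sum>r\<in>S4. fixed_count 3 b (triple (p \<circ> (q \<circ> r)) id id, rot_123))"
    by (intro sum.cong refl) blast
  also have "\<dots> = (\<Sum>q\<in>S4. \<Sum>r\<in>S4. \<Sum>p\<in>S4. fixed_count 3 b (triple (p \<circ> (q \<circ> r)) id id, rot_123))"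
    by (subst sum.swap) (intro sum.cong refl sum.swap)
  also have "\<dots> = (\<Sum>q\<in>S4. \<Sum>r\<in>S4. \<Sum>p\<in>S4. fixed_count 3 b (triple p id id, rot_123))"
    by (rule sum.cong[OF refl], rule sum.cong[OF refl], rule sum_permutations_compose_right[symmetric])
      (unfold mem_Collect_eq, rule permutes_compose)
  finally show ?thesis
    by (simp add: card_S4)
qed

section \<open>Class sums of solution counts\<close>

lemma class_sum_cong:
  assumes "\<And>r. r \<in> S4 \<Longrightarrow> f r = g r"
  shows "class_sum f = class_sum g"
proof -
  have "w * f r = w * g r" if "(w, r) \<in> set (zip class_sizes cycle_types)" for w r
    using that assms cycle_types_S4 by (metis set_zip_rightD subsetD)
  then show ?thesis
    unfolding weighted_sum_def by (intro arg_cong[of _ _ sum_list] map_cong) auto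
qed

text \<open>With trivial coordinate permutation the three letter permutations can be conjugated
  independently.\<close>

lemma sum_fixed_count_diag:
  "(\<Sum>p\<in>S4. \<Sum>q\<in>S4. \<Sum>r\<in>S4. fixed_count 3 b (triple p q r, id)) =
    class_sum (\<lambda>p. class_sum (\<lambda>q. class_sum (\<lambda>r.
      solution_count b (gauss 0 27 (fix_rows (\<lambda>(i, j, k). (p i, q j, r k)))))))"
proof -
  have conj: "fixed_count 3 b (triple p q r, id) = fixed_count 3 b (triple p' q' r', id)"
    if "p \<in> S4" "q \<in> S4" "r \<in> S4" "h1 \<in> S4" "h2 \<in> S4" "h3 \<in> S4"
      "h1 \<circ> p = p' \<circ> h1" "h2 \<circ> q = q' \<circ> h2" "h3 \<circ> r = r' \<circ> h3" for p q r p' q' r' h1 h2 h3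
    by (rule fixed_count_isotopy_3[OF that(1-6)]) (use that in \<open>auto simp: permutes_id\<close>)
  have "(\<Sum>p\<in>S4. \<Sum>q\<in>S4. \<Sum>r\<in>S4. fixed_count 3 b (triple p q r, id)) =
      class_sum (\<lambda>p. \<Sum>q\<in>S4. \<Sum>r\<in>S4. fixed_count 3 b (triple p q r, id))"
    by (rule sum_S4_classes, intro sum.cong refl, rule conj[where ?h2.0 = id and ?h3.0 = id])
      (auto simp: permutes_id)
  also have "\<dots> = class_sum (\<lambda>p. class_sum (\<lambda>q. \<Sum>r\<in>S4. fixed_count 3 b (triple p q r, id)))"
    by (rule class_sum_cong, rule sum_S4_classes, intro sum.cong refl,
        rule conj[where ?h1.0 = id and ?h3.0 = id]) (auto simp: permutes_id)
  also have "\<dots> = class_sum (\<lambda>p. class_sum (\<lambda>q. class_sum (\<lambda>r. fixed_count 3 b (triple p q r, id))))"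
    by (rule class_sum_cong, rule class_sum_cong, rule sum_S4_classes,
        rule conj[where ?h1.0 = id and ?h2.0 = id]) (auto simp: permutes_id)
  also have "\<dots> = class_sum (\<lambda>p. class_sum (\<lambda>q. class_sum (\<lambda>r.
      solution_count b (gauss 0 27 (fix_rows (\<lambda>(i, j, k). (p i, q j, r k)))))))"
    by (rule class_sum_cong, rule class_sum_cong, rule class_sum_cong, rule fixed_count_gauss)
      (auto simp: triple_in_moves move_triple permutes_id)
  finally show ?thesis .
qed

text \<open>The same \<open>h\<close> in coordinates 1 and 2 keeps the identity in coordinate 2 and
  conjugates \<open>p\<close>; coordinate 3 is conjugated independently.\<close>

lemma sum_fixed_count_swap_classes:
  "(\<Sum>p\<in>S4. \<Sum>r\<in>S4. fixed_count 3 b (triple p id r, swap_12)) =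
    class_sum (\<lambda>p. class_sum (\<lambda>r.
      solution_count b (gauss 0 27 (fix_rows (\<lambda>(i, j, k). (p j, i, r k))))))"
proof -
  have conj: "fixed_count 3 b (triple p id r, swap_12) = fixed_count 3 b (triple p' id r', swap_12)"
    if "p \<in> S4" "r \<in> S4" "h \<in> S4" "h' \<in> S4"
      "h \<circ> p = p' \<circ> h" "h' \<circ> r = r' \<circ> h'" for p r p' r' h h'
    by (rule fixed_count_isotopy_3[OF that(1) id_S4 that(2) that(3) that(3) that(4)])
      (use that in \<open>auto simp: coord_perms[simplified] swap_12_simps\<close>)
  have "(\<Sum>p\<in>S4. \<Sum>r\<in>S4. fixed_count 3 b (triple p id r, swap_12)) =
      class_sum (\<lambda>p. \<Sum>r\<in>S4. fixed_count 3 b (triple p id r, swap_12))"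
    by (rule sum_S4_classes, intro sum.cong refl, rule conj[where h' = id]) (auto simp: permutes_id)
  also have "\<dots> = class_sum (\<lambda>p. class_sum (\<lambda>r. fixed_count 3 b (triple p id r, swap_12)))"
    by (rule class_sum_cong, rule sum_S4_classes, rule conj[where h = id]) (auto simp: permutes_id)
  also have "\<dots> = class_sum (\<lambda>p. class_sum (\<lambda>r.
      solution_count b (gauss 0 27 (fix_rows (\<lambda>(i, j, k). (p j, i, r k))))))"
    by (rule class_sum_cong, rule class_sum_cong, rule fixed_count_gauss)
      (auto simp: triple_in_moves move_triple permutes_id coord_perms[simplified] swap_12_simps)
  finally show ?thesis .
qed

text \<open>A common \<open>h\<close> in all three coordinates keeps both identities and conjugates
  \<open>p\<close>.\<close>

lemma sum_fixed_count_rot_classes: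
  "(\<Sum>p\<in>S4. fixed_count 3 b (triple p id id, rot_123)) =
    class_sum (\<lambda>p. solution_count b (gauss 0 27 (fix_rows (\<lambda>(i, j, k). (p j, k, i)))))"
proof -
  have conj: "fixed_count 3 b (triple p id id, rot_123) = fixed_count 3 b (triple p' id id, rot_123)"
    if "p \<in> S4" "h \<in> S4" "h \<circ> p = p' \<circ> h" for p p' h
    by (rule fixed_count_isotopy_3[OF that(1) id_S4 id_S4 that(2) that(2) that(2)])
      (use that in \<open>auto simp: coord_perms[simplified] rot_123_simps\<close>)
  have "(\<Sum>p\<in>S4. fixed_count 3 b (triple p id id, rot_123)) =
      class_sum (\<lambda>p. fixed_count 3 b (triple p id id, rot_123))"
    by (rule sum_S4_classes, rule conj) auto
  also have "\<dots> = class_sum (\<lambda>p. solution_count b (gauss 0 27 (fix_rows (\<lambda>(i, j, k). (p j, k, i)))))"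
    by (rule class_sum_cong, rule fixed_count_gauss)
      (auto simp: triple_in_moves move_triple permutes_id coord_perms[simplified] rot_123_simps)
  finally show ?thesis .
qed

text \<open>Each entry pairs the dimension of the space of unitrades fixed by an isotopy with the
  existence of a unitrade sent to its complement. Each group of five lines belongs to one
  \<open>p\<close>, each line to one \<open>q\<close>, and each entry in it to one
  \<open>r\<close>.\<close>

lemma gauss_diag:
  "map (\<lambda>(p, q, r). gauss 0 27 (fix_rows (\<lambda>(i, j, k). (p i, q j, r k))))
    (List.product cycle_types (List.product cycle_types cycle_types)) =
   [(27, False), (18, False), (18, True), (9, False), (9, True),
    (18, False), (15, False), (15, True), (6, False), (9, True),
    (18, True), (15, True), (15, True), (6, True), (9, True),
    (9, False), (6, False), (6, True), (9, False), (3, True),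
    (9, True), (9, True), (9, True), (3, True), (9, True),
    (18, False), (15, False), (15, True), (6, False), (9, True),
    (15, False), (14, False), (14, True), (5, False), (9, True),
    (15, True), (14, True), (14, True), (5, True), (9, True),
    (6, False), (5, False), (5, True), (6, False), (3, True),
    (9, True), (9, True), (9, True), (3, True), (8, True),
    (18, True), (15, True), (15, True), (6, True), (9, True),
    (15, True), (14, True), (14, True), (5, True), (9, True),
    (15, True), (14, True), (14, True), (5, True), (9, True),
    (6, True), (5, True), (5, True), (6, True), (3, True),
    (9, True), (9, True), (9, True), (3, True), (8, True),
    (9, False), (6, False), (6, True), (9, False), (3, True),
    (6, False), (5, False), (5, True), (6, False), (3, True),
    (6, True), (5, True), (5, True), (6, True), (3, True),
    (9, False), (6, False), (6, True), (9, False), (3, True),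
    (3, True), (3, True), (3, True), (3, True), (3, True),
    (9, True), (9, True), (9, True), (3, True), (9, True),
    (9, True), (9, True), (9, True), (3, True), (8, True),
    (9, True), (9, True), (9, True), (3, True), (8, True),
    (3, True), (3, True), (3, True), (3, True), (3, True),
    (9, True), (8, True), (8, True), (3, True), (7, True)]"
  by code_simp

lemma gauss_swap:
  "map (\<lambda>(p, r). gauss 0 27 (fix_rows (\<lambda>(i, j, k). (p j, i, r k))))
    (List.product cycle_types cycle_types) =
   [(18, False), (15, False), (15, True), (6, False), (9, True),
    (9, False), (8, False), (8, True), (3, False), (7, True),
    (9, True), (8, True), (8, True), (3, True), (7, True),
    (6, False), (5, False), (5, True), (6, False), (3, True),
    (6, True), (5, True), (5, True), (2, True), (4, True)]"
  by code_simp

lemma gauss_rot: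
  "map (\<lambda>p. gauss 0 27 (fix_rows (\<lambda>(i, j, k). (p j, k, i)))) cycle_types =
   [(11, False), (6, False), (6, True), (3, False), (3, True)]"
  by code_simp

text \<open>The three tables enter with the factors 1, \<open>3 * 24\<close> and
  \<open>2 * 576\<close>: the number of conjugate coordinate permutations times the number of letter
  permutations shifted away. The divisor \<open>82944 = 6 * 24 ^ 3\<close> is the number of
  moves.\<close>

lemma sum_fixed_count_value:
  "(\<Sum>g\<in>moves 3. fixed_count 3 b g) = 82944 * (if b then 312 else 2528)"
proof -
  have length_product: "length (weight_product class_sizes class_sizes) =
      length (List.product cycle_types cycle_types)"
    by (simp add: weight_product_def length_cycle_types)
  have diag: "(\<Sum>p\<in>S4. \<Sum>q\<in>S4. \<Sum>r\<in>S4. fixed_count 3 b (triple p q r, id)) =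
      weighted_sum (weight_product class_sizes (weight_product class_sizes class_sizes))
        (map (\<lambda>(p, q, r). gauss 0 27 (fix_rows (\<lambda>(i, j, k). (p i, q j, r k))))
          (List.product cycle_types (List.product cycle_types cycle_types))) (solution_count b)"
    unfolding weighted_sum_map sum_fixed_count_diag
    by (simp add: weighted_sum_product[symmetric] length_cycle_types length_product)
  have swap: "(\<Sum>p\<in>S4. \<Sum>r\<in>S4. fixed_count 3 b (triple p id r, swap_12)) =
      weighted_sum (weight_product class_sizes class_sizes)
        (map (\<lambda>(p, r). gauss 0 27 (fix_rows (\<lambda>(i, j, k). (p j, i, r k))))
          (List.product cycle_types cycle_types)) (solution_count b)"
    unfolding weighted_sum_map sum_fixed_count_swap_classes
    by (simp add: weighted_sum_product[symmetric] length_cycle_types)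
  have rot: "(\<Sum>p\<in>S4. fixed_count 3 b (triple p id id, rot_123)) =
      weighted_sum class_sizes
        (map (\<lambda>p. gauss 0 27 (fix_rows (\<lambda>(i, j, k). (p j, k, i)))) cycle_types) (solution_count b)"
    unfolding weighted_sum_map by (rule sum_fixed_count_rot_classes)
  show ?thesis
    unfolding sum_fixed_count_moves_3 sum_fixed_count_swap sum_fixed_count_rot
      diag swap rot gauss_diag gauss_swap gauss_rot
    by (cases b) (simp_all add: weighted_sum_def weight_product_def class_sizes_def)
qed

theorem theorem3:
  shows "card (unitrades 3) = 2 ^ 27 \<and>
         card (unitrades 3 // unitrade_equiv 3) = 2528 \<and>
         card {C \<in> unitrades 3 // unitrade_equiv 3.
                 \<exists>S\<in>C. equivalent 3 S (words 3 - S)} = 312"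
proof (intro conjI)
  show "card (unitrades 3) = 2 ^ 27"
    by (rule card_unitrades_3)
  \<comment> \<open>Classes are nonempty and equivalence is reflexive, so for
    \<open>b = False\<close> the stability condition selects every class.\<close>
  have "\<exists>S\<in>C. equivalent 3 S S" if C: "C \<in> unitrades 3 // unitrade_equiv 3" for C
  proof -
    obtain S where S: "S \<in> C"
      using in_quotient_imp_non_empty[OF equiv_unitrade_equiv C] by blast
    then have "(S, S) \<in> unitrade_equiv 3"
      using in_quotient_imp_subset[OF equiv_unitrade_equiv C] equiv_unitrade_equiv[of 3]
      by (meson equivE refl_onD subsetD)
    then show ?thesis
      using S unfolding unitrade_equiv_def by blast
  qed
  then have "{C \<in> unitrades 3 // unitrade_equiv 3. \<exists>S\<in>C. equivalent 3 S (opposite 3 False S)} =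
      unitrades 3 // unitrade_equiv 3"
    by (auto simp: opposite_def)
  then show "card (unitrades 3 // unitrade_equiv 3) = 2528"
    using sum_fixed_count[of 3 False] by (simp add: sum_fixed_count_value card_moves_3)
  show "card {C \<in> unitrades 3 // unitrade_equiv 3. \<exists>S\<in>C. equivalent 3 S (words 3 - S)} = 312"
    using sum_fixed_count[of 3 True] by (simp add: sum_fixed_count_value card_moves_3 opposite_def)
qed

end
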